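(* Let $T$ be an analytic full branch map on $[-1,1]$ as in the setting below with $r/R<1/\gamma$, where $\gamma=(1+\sqrt2)^2$, and take $\rho=\sqrt{rR/\gamma}$ (so $\rho\in(r,R)$). Then there exist $C_1,C_2>0$ such that for all $N\in\mathbb{N}_0$ and all $M\ge C_1N^2\gamma^N$ (and any $0\le\delta\le 2/M$), \[ \|V_N(H_N^{(M)})^\dagger G_N^{(M)}V_N^{-1}-L\|_{\ell^2}\le C_2\left(\frac{(\gamma rR)^{N/2}N^2}{M}+\left(\frac{\gamma r}{R}\right)^{N/2}\right). \]
   Context: $T\colon[-1,1]\to[-1,1]$ is an analytic full branch map: closed intervals $I_1,\dots,I_d$ with disjoint interiors covering $[-1,1]$, $T|_{\mathrm{int}(I_\ell)}$ an analytic diffeomorphism with $\overline{T(I_\ell)}=[-1,1]$; inverse branches $\varphi_\ell$ extend to bounded holomorphic functions on $D_R=\{|z|<R\}$ with $\bigcup_\ell\varphi_\ell(D_R)\subseteq D_r$, $1<r<R$. Transfer operator: $(\mathcal{L}f)(z)=\sum_\ell\sigma_\ell\varphi_\ell'(z)f(\varphi_\ell(z))$, $\sigma_\ell=\mathrm{sgn}(\varphi_\ell'(0))$. $H^2(D_\rho)$ is the Hardy space on $D_\rho$ with inner product $(\cdot,\cdot)$ and orthonormal basis $e_n(z)=(z/\rho)^n$; $L$ is the matrix $L_{k\ell}=(\mathcal{L}e_\ell,e_k)$ viewed as an operator on $\ell^2(\mathbb{N}_0)$. $V_N$ and $V_N^{-1}$ are the diagonal operators on $\ell^2(\mathbb{N}_0)$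 with entries $\rho^n$, resp. $\rho^{-n}$, for $n<N$ and $0$ for $n\ge N$. Nodes: $x_m=-1+\delta+2m/M$, $m=0,\dots,M-1$, $0\le\delta\le2/M$. $\hat H_N^{(M)}$, $\hat G_N^{(M)}$ are the $N\times N$ matrices $(\hat H_N^{(M)})_{k\ell}=\frac1M\sum_mx_m^kx_m^\ell$, $(\hat G_N^{(M)})_{k\ell}=\frac1M\sum_m(T(x_m))^kx_m^\ell$ ($k,\ell\in\{0,\dots,N-1\}$); $G_N^{(M)}$ is the lift of $\hat G_N^{(M)}$ to $\ell^2(\mathbb{N}_0)$ (zero outside the first $N\times N$ block), and $(H_N^{(M)})^\dagger$ is the lift of $(\hat H_N^{(M)})^{-1}$ (which exists for $M\ge N$). $\|\cdot\|_{\ell^2}$ is the operator norm. *)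

theory Defs
  imports "HOL-Analysis.Analysis"
begin

definition full_branch_map ::
  "(real \<Rightarrow> real) \<Rightarrow> nat \<Rightarrow> (nat \<Rightarrow> real) \<Rightarrow> (nat \<Rightarrow> real) \<Rightarrow>
   (nat \<Rightarrow> complex \<Rightarrow> complex) \<Rightarrow> real \<Rightarrow> real \<Rightarrow> bool" where
  "full_branch_map T d a b phi r R \<longleftrightarrow>
     d \<ge> 1 \<and> 1 < r \<and> r < R \<and>
     (\<forall>x\<in>{-1..1}. T x \<in> {-1..1}) \<and>
     (\<forall>l<d. -1 \<le> a l \<and> a l < b l \<and> b l \<le> 1) \<and>
     (\<Union>l<d. {a l..b l}) = {-1..1} \<and>
     (\<forall>l<d. \<forall>l'<d. l \<noteq> l' \<longrightarrow> {a l<..<b l} \<inter> {a l'<..<b l'} = {}) \<and>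
     (\<forall>l<d.
        \<comment> \<open>T restricted to the open interval is a diffeomorphism onto (-1,1)\<close>
        (\<forall>x\<in>{a l<..<b l}. \<exists>D. D \<noteq> 0 \<and> (T has_real_derivative D) (at x)) \<and>
        bij_betw T {a l<..<b l} {-1<..<1} \<and>
        \<comment> \<open>phi l is the inverse branch\<close>
        (\<forall>y\<in>{-1<..<1}. phi l (complex_of_real y) = complex_of_real (the_inv_into {a l<..<b l} T y)) \<and>
        phi l holomorphic_on ball 0 R \<and>
        bounded (phi l ` ball 0 R) \<and>
        phi l ` ball 0 R \<subseteq> ball 0 r)"

text \<open>sigma_l = sgn(phi_l'(0)) (phi_l'(0) is real and nonzero).\<close>
definition branch_sign :: "(nat \<Rightarrow> complex \<Rightarrow> complex) \<Rightarrow> nat \<Rightarrow> complex" where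
  "branch_sign phi l = complex_of_real (sgn (Re (deriv (phi l) 0)))"

definition transfer_op ::
  "nat \<Rightarrow> (nat \<Rightarrow> complex \<Rightarrow> complex) \<Rightarrow> (complex \<Rightarrow> complex) \<Rightarrow> complex \<Rightarrow> complex" where
  "transfer_op d phi f z = (\<Sum>l<d. branch_sign phi l * deriv (phi l) z * f (phi l z))"

definition hardy_inner :: "real \<Rightarrow> (complex \<Rightarrow> complex) \<Rightarrow> (complex \<Rightarrow> complex) \<Rightarrow> complex" where
  "hardy_inner \<rho> f g = Lim (at_left \<rho>)
     (\<lambda>s. integral {0..2*pi} (\<lambda>t. f (of_real s * cis t) * cnj (g (of_real s * cis t))) / (2 * pi))"

definition hardy_basis :: "real \<Rightarrow> nat \<Rightarrow> complex \<Rightarrow> complex" where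
  "hardy_basis \<rho> n z = (z / of_real \<rho>) ^ n"

definition transfer_matrix ::
  "nat \<Rightarrow> (nat \<Rightarrow> complex \<Rightarrow> complex) \<Rightarrow> real \<Rightarrow> nat \<Rightarrow> nat \<Rightarrow> complex" where
  "transfer_matrix d phi \<rho> k l =
     hardy_inner \<rho> (transfer_op d phi (hardy_basis \<rho> l)) (hardy_basis \<rho> k)"

text \<open>ell^2 norm of a sequence (infinite if not square summable), and the operator norm
  of an infinite matrix acting on ell^2(N_0), computed as the supremum over unit vectors
  of finite support (a dense subspace); it is infinite iff the matrix is unbounded.\<close>
definition l2_norm_seq :: "(nat \<Rightarrow> complex) \<Rightarrow> ennreal" where
  "l2_norm_seq v = (if summable (\<lambda>k. (cmod (v k))\<^sup>2)
                    then ennreal (sqrt (\<Sum>k. (cmod (v k))\<^sup>2)) else \<infinity>)"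

definition l2_opnorm :: "(nat \<Rightarrow> nat \<Rightarrow> complex) \<Rightarrow> ennreal" where
  "l2_opnorm A = (SUP (n, x) \<in> {(n, x). (\<forall>j\<ge>n. x j = 0) \<and> l2_norm_seq x \<le> 1}.
                    l2_norm_seq (\<lambda>k. \<Sum>j<n. A k j * x j))"

definition block_inverse :: "nat \<Rightarrow> (nat \<Rightarrow> nat \<Rightarrow> real) \<Rightarrow> nat \<Rightarrow> nat \<Rightarrow> real" where
  "block_inverse N A = (THE B. (\<forall>i j. (N \<le> i \<or> N \<le> j) \<longrightarrow> B i j = 0) \<and>
      (\<forall>i<N. \<forall>j<N. (\<Sum>k<N. A i k * B k j) = (if i = j then 1 else 0)) \<and>
      (\<forall>i<N. \<forall>j<N. (\<Sum>k<N. B i k * A k j) = (if i = j then 1 else 0)))"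

definition node :: "nat \<Rightarrow> real \<Rightarrow> nat \<Rightarrow> real" where
  "node M \<delta> m = -1 + \<delta> + 2 * real m / real M"

definition H_mat :: "nat \<Rightarrow> nat \<Rightarrow> real \<Rightarrow> nat \<Rightarrow> nat \<Rightarrow> real" where
  "H_mat N M \<delta> k l = (if k < N \<and> l < N then
      (\<Sum>m<M. node M \<delta> m ^ k * node M \<delta> m ^ l) / real M else 0)"

definition G_mat :: "(real \<Rightarrow> real) \<Rightarrow> nat \<Rightarrow> nat \<Rightarrow> real \<Rightarrow> nat \<Rightarrow> nat \<Rightarrow> real" where
  "G_mat T N M \<delta> k l = (if k < N \<and> l < N then
      (\<Sum>m<M. T (node M \<delta> m) ^ k * node M \<delta> m ^ l) / real M else 0)"

definition edmd_matrix :: "(real \<Rightarrow> real) \<Rightarrow> real \<Rightarrow> nat \<Rightarrow> nat \<Rightarrow> real \<Rightarrow> nat \<Rightarrow> nat \<Rightarrow> complex" where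
  "edmd_matrix T \<rho> N M \<delta> k l = (if k < N \<and> l < N then
      complex_of_real (\<rho> ^ k * (\<Sum>j<N. block_inverse N (H_mat N M \<delta>) k j * G_mat T N M \<delta> j l)
                       / \<rho> ^ l) else 0)"

end

theory Submission
  imports Defs "HOL-Complex_Analysis.Complex_Analysis" "Jordan_Normal_Form.Determinant"
begin

text \<open>Let $f_l=\mathcal{L}z^l$ with Taylor coefficients $c_{kl}$, and let $H$, $G$ be the matrices of
  the statement. After the change of variables $y=T(x)$, the entry $G_{kl}$ is a quadrature of
  $\frac12\int y^kf_l(y)\,dy$, and $H$ is one of the Gram matrix of the monomials. Both errors are
  $O(N/M)$ per entry. The $l$-th column $u$ of $H^{-1}G$ minus the truncated coefficients $(c_{kl})_{k<N}$
  solves $Hu=w+Q$, where $w$ collects quadrature errors and $Q_k=\frac12\int y^kq(y)\,dy$ for the Taylor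
  tail $q$ of $f_l$.

  Expanding in Chebyshev polynomials of the second kind shows that the Gram matrix is at least
  $\frac12\gamma^{-N}$, and for large $M$ the matrix $H$ inherits this up to a factor $2$. Hence $w$ costs a
  factor $\gamma^N$, but $Q$ only $\gamma^{N/2}$. Cauchy estimates on a radius $R'\in(\rho,R)$ with
  $R'\sqrt\gamma\ge R$ then bound every column of the difference, with geometric decay in $l$, so the
  operator norm is controlled by the sum of the column norms.\<close>

section \<open>Quadrature at equidistant nodes\<close>

text \<open>Why Q is cheaper than w: testing H u = w + Q with u bounds the energy of the polynomial
  p with coefficients u. Q pairs with u as the integral of p q, which the L^2 norm of p controls
  directly, whereas w pairs with u as a vector, and passing from p to u costs (1 + sqrt 2)^N.
  Recovering u from p at the end costs this factor once more in both cases. Where the two rates come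
  from: conjugation by the diagonal matrices multiplies row k by \<rho>^k \<le> \<rho>^N, which
  turns \<gamma>^N into (\<gamma> r R)^(N/2). The columns l \<ge> N, absent from the discrete
  matrix, are of order (r/\<rho>)^N = (\<gamma> r/R)^(N/2), and this sets the second rate. The
  Taylor tail only has to be no worse, which is the condition on R'. A radius strictly below R is
  taken because bounded inverse branches may have unbounded derivatives on the whole disc.\<close>

lemma card_nat_open_interval:
  fixes \<alpha> \<beta> :: real
  assumes "-1 \<le> \<alpha>" "\<alpha> \<le> \<beta>" "\<beta> \<le> real M"
  shows "\<bar>real (card {m. m < M \<and> \<alpha> < real m \<and> real m < \<beta>}) - (\<beta> - \<alpha>)\<bar> \<le> 1"
proof -
  \<comment> \<open>The bounds on \<alpha> and \<beta> make the restriction to indices below M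
    automatic: an integer above \<alpha> \<ge> -1 is a natural number.\<close>
  have "{m. m < M \<and> \<alpha> < real m \<and> real m < \<beta>} = nat ` {\<lfloor>\<alpha>\<rfloor> + 1..\<lceil>\<beta>\<rceil> - 1}"
  proof (intro Set.set_eqI iffI)
    fix m assume "m \<in> {m. m < M \<and> \<alpha> < real m \<and> real m < \<beta>}"
    then have "int m \<in> {\<lfloor>\<alpha>\<rfloor> + 1..\<lceil>\<beta>\<rceil> - 1}"
      by (simp add: floor_less_iff less_ceiling_iff add1_zle_eq)
    then show "m \<in> nat ` {\<lfloor>\<alpha>\<rfloor> + 1..\<lceil>\<beta>\<rceil> - 1}"
      by (metis image_eqI nat_int)
  next
    fix m assume "m \<in> nat ` {\<lfloor>\<alpha>\<rfloor> + 1..\<lceil>\<beta>\<rceil> - 1}"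
    then obtain i where i: "m = nat i" "\<lfloor>\<alpha>\<rfloor> + 1 \<le> i" "i \<le> \<lceil>\<beta>\<rceil> - 1" by auto
    from i(2) have "\<lfloor>\<alpha>\<rfloor> < i" by simp
    then have "\<alpha> < of_int i" by (simp add: floor_less_iff)
    moreover have "i < \<lceil>\<beta>\<rceil>" using i by simp
    then have "of_int i < \<beta>" by (simp add: less_ceiling_iff)
    moreover have "0 \<le> i" using \<open>\<alpha> < of_int i\<close> assms(1) by linarith
    ultimately show "m \<in> {m. m < M \<and> \<alpha> < real m \<and> real m < \<beta>}"
      using i(1) assms(3) by auto
  qed
  moreover have "0 \<le> \<lfloor>\<alpha>\<rfloor> + 1" using assms(1) by linarith
  then have "inj_on nat {\<lfloor>\<alpha>\<rfloor> + 1..\<lceil>\<beta>\<rceil> - 1}"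
    by (auto simp: inj_on_def)
  ultimately have "card {m. m < M \<and> \<alpha> < real m \<and> real m < \<beta>} = nat (\<lceil>\<beta>\<rceil> - 1 - \<lfloor>\<alpha>\<rfloor>)"
    by (simp add: card_image)
  \<comment> \<open>\<open>nat\<close> truncates only when \<alpha> = \<beta> is an integer, and
    then the length is 0 as well.\<close>
  then show ?thesis using assms(2) by linarith
qed

text \<open>The conditions on the node are solved for its index. As \<delta> is at most one spacing,
  the left end of the index interval may drop to -1 but not below, and the error is one spacing
  wherever the interval lies.\<close>

lemma card_nodes_open_interval:
  assumes "1 \<le> M" "0 \<le> \<delta>" "\<delta> \<le> 2 / real M" "-1 \<le> u" "u \<le> v" "v \<le> 1"
  shows "\<bar>2 / real M * real (card {m. m < M \<and> u < node M \<delta> m \<and> node M \<delta> m < v}) - (v - u)\<bar> \<le> 2 / real M"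
proof -
  define \<alpha> where "\<alpha> = (u + 1 - \<delta>) * real M / 2"
  define \<beta> where "\<beta> = (v + 1 - \<delta>) * real M / 2"
  have M: "0 < real M" using assms by simp
  have eq: "{m. m < M \<and> u < node M \<delta> m \<and> node M \<delta> m < v} = {m. m < M \<and> \<alpha> < real m \<and> real m < \<beta>}"
    using M by (auto simp: node_def \<alpha>_def \<beta>_def field_simps)
  have dM: "\<delta> * real M \<le> 2" using assms M by (simp add: field_simps)
  have "0 \<le> (u + 1) * real M" using assms by simp
  then have "-1 \<le> \<alpha>" using dM by (simp add: \<alpha>_def algebra_simps)
  moreover have "\<alpha> \<le> \<beta>" unfolding \<alpha>_def \<beta>_def using assms
    by (intro divide_right_mono mult_right_mono) auto
  moreover have "(v + 1 - \<delta>) * real M \<le> 2 * real M" using assms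
    by (intro mult_right_mono) auto
  then have "\<beta> \<le> real M" by (simp add: \<beta>_def)
  ultimately have "\<bar>real (card {m. m < M \<and> \<alpha> < real m \<and> real m < \<beta>}) - (\<beta> - \<alpha>)\<bar> \<le> 1"
    by (rule card_nat_open_interval)
  then have e1: "2 / real M * \<bar>real (card {m. m < M \<and> \<alpha> < real m \<and> real m < \<beta>}) - (\<beta> - \<alpha>)\<bar> \<le> 2 / real M * 1"
    by (intro mult_left_mono) auto
  have e2: "2 / real M * (real (card {m. m < M \<and> \<alpha> < real m \<and> real m < \<beta>}) - (\<beta> - \<alpha>))
      = 2 / real M * real (card {m. m < M \<and> \<alpha> < real m \<and> real m < \<beta>}) - (v - u)"
    using M by (simp add: \<alpha>_def \<beta>_def field_simps)
  have "0 \<le> 2 / real M" by simp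
  show ?thesis
    using e1 unfolding eq e2 abs_mult_pos'[OF \<open>0 \<le> 2 / real M\<close>] by simp
qed

lemma node_in_range:
  assumes "m < M" "0 \<le> \<delta>" "\<delta> \<le> 2 / real M"
  shows "node M \<delta> m \<in> {-1..1}"
proof -
  have "real (Suc m) \<le> real M" using assms by simp
  then have "2 * (real m + 1) / real M \<le> 2" using assms by (simp add: field_simps)
  then have "2 * real m / real M + 2 / real M \<le> 2"
    by (simp add: add_divide_distrib distrib_left)
  moreover have "0 \<le> 2 * real m / real M" by simp
  ultimately show ?thesis using assms unfolding node_def atLeastAtMost_iff by linarith
qed

lemma inj_on_node: "inj_on (node M \<delta>) {..<M}"
  by (auto simp: inj_on_def node_def)

text \<open>Write $y=T(x)$ and $g(y)=y^k\psi(y)^l$. Integrating $g'$ turns the node sum, and integration by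
  parts turns the integral, into an integral of $g'$ against the number of nodes in, resp. the
  length of, the interval $\{x\in(a,b) : T(x)>s\}$. Thus only node counts are compared, and
  $\psi'$ may vanish at $\pm1$, where $T$ has an infinite slope.\<close>
lemma branch_quadrature:
  fixes T \<psi> \<psi>' :: "real \<Rightarrow> real"
  assumes M: "1 \<le> M" and \<delta>: "0 \<le> \<delta>" "\<delta> \<le> 2 / real M"
    and ab: "-1 \<le> a" "a < b" "b \<le> 1"
    and der: "\<And>y. y \<in> {-1..1} \<Longrightarrow> (\<psi> has_real_derivative \<psi>' y) (at y within {-1..1})"
    and cont: "continuous_on {-1..1} \<psi>'"
    and \<sigma>: "\<sigma> = 1 \<or> \<sigma> = -1" and pos: "\<And>y. y \<in> {-1<..<1} \<Longrightarrow> \<sigma> * \<psi>' y > 0"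
    and inv1: "\<And>x. x \<in> {a<..<b} \<Longrightarrow> T x \<in> {-1<..<1} \<and> \<psi> (T x) = x"
    and inv2: "\<And>y. y \<in> {-1<..<1} \<Longrightarrow> \<psi> y \<in> {a<..<b} \<and> T (\<psi> y) = y"
  shows "\<bar>2 / real M * (\<Sum>m | m < M \<and> node M \<delta> m \<in> {a<..<b}. T (node M \<delta> m) ^ k * node M \<delta> m ^ l)
            - integral {-1..1} (\<lambda>y. \<sigma> * \<psi>' y * (y ^ k * \<psi> y ^ l))\<bar>
         \<le> 2 / real M * (1 + 2 * real k + 2 * real l)"
proof -
  define S where "S = {m. m < M \<and> node M \<delta> m \<in> {a<..<b}}"
  have finS: "finite S" by (simp add: S_def)
  have cont\<psi>: "continuous_on {-1..1} \<psi>"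
    using der by (meson DERIV_continuous continuous_on_eq_continuous_within)
  have at_interior: "at y within {-1..1} = at y" if "y \<in> {-1<..<1}" for y :: real
    by (rule at_within_interior) (use that in auto)
  have \<psi>ab: "\<psi> y \<in> {a..b}" if "y \<in> {-1..1}" for y
  proof -
    have "\<psi> ` closure {-1<..<1} \<subseteq> {a..b}"
      by (rule image_closure_subset) (use cont\<psi> inv2 in \<open>auto simp: less_imp_le\<close>)
    then show ?thesis using that by (auto simp: image_subset_iff)
  qed
  have smono: "\<sigma> * \<psi> s < \<sigma> * \<psi> t" if "-1 \<le> s" "s < t" "t \<le> 1" for s t
  proof (rule DERIV_pos_imp_increasing_open[OF that(2)])
    fix y assume y: "s < y" "y < t"
    then have "y \<in> {-1<..<1}" using that by auto
    moreover from this have "((\<lambda>y. \<sigma> * \<psi> y) has_real_derivative \<sigma> * \<psi>' y) (at y)"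
      using der[of y] at_interior[of y] by (intro DERIV_cmult) auto
    ultimately show "\<exists>z. ((\<lambda>y. \<sigma> * \<psi> y) has_real_derivative z) (at y) \<and> 0 < z"
      using pos by blast
  next
    show "continuous_on {s..t} (\<lambda>y. \<sigma> * \<psi> y)"
      by (intro continuous_intros continuous_on_subset[OF cont\<psi>]) (use that in auto)
  qed
  \<comment> \<open>Monotonicity turns the set where T exceeds s into an interval with one end at
    \<psi> s; \<sigma> decides whether its other end is b or a.\<close>
  have super: "s < T x \<longleftrightarrow> \<sigma> * \<psi> s < \<sigma> * x" if "x \<in> {a<..<b}" "s \<in> {-1..1}" for x s
    using smono[of s "T x"] smono[of "T x" s] inv1[OF that(1)] that
    by (cases "s < T x"; cases "s = T x") auto
  have \<sigma>\<sigma>: "\<sigma> * (\<sigma> * t) = t" for t using \<sigma> by auto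
  \<comment> \<open>The inverse is known only over the open interval. Continuity keeps \<psi> inside
    [a,b] at \<plusminus>1, and every point of (a,b) lies strictly between \<psi>(-1) and \<psi>(1),
    so these two values are the ends.\<close>
  have endpoints: "\<sigma> * (\<psi> 1 - \<psi> (-1)) = b - a"
  proof -
    have lo: "\<sigma> * \<psi> (-1) < \<sigma> * x" "\<sigma> * x < \<sigma> * \<psi> 1" if "x \<in> {a<..<b}" for x
      using smono[of "-1" "T x"] smono[of "T x" 1] inv1[OF that] by auto
    show ?thesis
    proof (cases "\<sigma> = 1")
      case True
      have "\<psi> (-1) \<le> a" using lo(1) True ab
        by (intro dense_ge_bounded[of a b]) (auto intro: less_imp_le)
      moreover have "b \<le> \<psi> 1" using lo(2) True ab
        by (intro dense_le_bounded[of a b]) (auto intro: less_imp_le)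
      ultimately show ?thesis using \<psi>ab[of 1] \<psi>ab[of "-1"] True by auto
    next
      case False
      then have s: "\<sigma> = -1" using \<sigma> by auto
      have "\<psi> 1 \<le> a" using lo(2) s ab
        by (intro dense_ge_bounded[of a b]) (auto intro: less_imp_le)
      moreover have "b \<le> \<psi> (-1)" using lo(1) s ab
        by (intro dense_le_bounded[of a b]) (auto intro: less_imp_le)
      ultimately show ?thesis using \<psi>ab[of 1] \<psi>ab[of "-1"] s by auto
    qed
  qed
  have h_le: "\<bar>2 / real M * real (card {m \<in> S. s < T (node M \<delta> m)}) - \<sigma> * (\<psi> 1 - \<psi> s)\<bar> \<le> 2 / real M"
    if s: "s \<in> {-1..1}" for s
  proof (cases "\<sigma> = 1")
    case True
    have "\<psi> 1 = b"
      using endpoints True \<psi>ab[of 1] \<psi>ab[of "-1"] by auto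
    moreover have "{m \<in> S. s < T (node M \<delta> m)} = {m. m < M \<and> \<psi> s < node M \<delta> m \<and> node M \<delta> m < b}"
      using super[OF _ s] \<psi>ab[OF s] True by (auto simp: S_def)
    ultimately show ?thesis
      using card_nodes_open_interval[OF M \<delta>, of "\<psi> s" b] \<psi>ab[OF s] ab True by auto
  next
    case False
    then have s': "\<sigma> = -1" using \<sigma> by auto
    have "\<psi> 1 = a"
      using endpoints s' \<psi>ab[of 1] \<psi>ab[of "-1"] by auto
    moreover have "{m \<in> S. s < T (node M \<delta> m)} = {m. m < M \<and> a < node M \<delta> m \<and> node M \<delta> m < \<psi> s}"
      using super[OF _ s] \<psi>ab[OF s] s' by (auto simp: S_def)
    ultimately show ?thesis
      using card_nodes_open_interval[OF M \<delta>, of a "\<psi> s"] \<psi>ab[OF s] ab s' by auto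
  qed
  define g where "g = (\<lambda>y. y ^ k * \<psi> y ^ l)"
  define g' where "g' = (\<lambda>y. real k * y ^ (k - 1) * \<psi> y ^ l + y ^ k * (real l * \<psi> y ^ (l - 1) * \<psi>' y))"
  have dg: "(g has_real_derivative g' y) (at y within {-1..1})" if "y \<in> {-1..1}" for y
    unfolding g_def g'_def by (auto intro!: derivative_eq_intros der that)
  have contg': "continuous_on {-1..1} g'"
    unfolding g'_def by (intro continuous_intros cont\<psi> cont)
  have abs1: "\<bar>\<psi> y ^ n\<bar> \<le> 1" "\<bar>y ^ n\<bar> \<le> 1" if "y \<in> {-1..1}" for y and n :: nat
    using \<psi>ab[OF that] ab that by (auto simp: power_abs intro!: power_le_one)
  have pos': "0 \<le> \<sigma> * \<psi>' y" if "y \<in> {-1..1}" for y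
  proof -
    have "continuous_on (closure {-1<..<1}) (\<lambda>y. \<sigma> * \<psi>' y)"
      using cont by (simp add: continuous_on_mult_left)
    then have "(\<lambda>y. \<sigma> * \<psi>' y) ` closure {-1<..<1} \<subseteq> {0..}"
      by (rule image_closure_subset) (use pos in \<open>force simp: less_imp_le\<close>)+
    then show ?thesis using that by (auto simp: image_subset_iff)
  qed
  have abs\<psi>': "\<bar>\<psi>' y\<bar> = \<sigma> * \<psi>' y" if "y \<in> {-1..1}" for y
    using pos'[OF that] \<sigma> by auto
  \<comment> \<open>\<sigma> \<psi>' is kept in the bound instead of a supremum: its integral is b -
    a \<le> 2, so the final error does not depend on how large the derivative of the branch
    is.\<close>
  have g'_le: "\<bar>g' y\<bar> \<le> real k + real l * (\<sigma> * \<psi>' y)" if y: "y \<in> {-1..1}" for y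
  proof -
    have "\<bar>real k * y ^ (k - 1) * \<psi> y ^ l\<bar> \<le> real k * 1 * 1"
      unfolding abs_mult by (intro mult_mono abs1 y) auto
    moreover have "\<bar>y ^ k * (real l * \<psi> y ^ (l - 1) * \<psi>' y)\<bar> \<le> 1 * (real l * 1 * (\<sigma> * \<psi>' y))"
      unfolding abs_mult abs\<psi>'[OF y, symmetric] by (intro mult_mono abs1 y) auto
    ultimately show ?thesis unfolding g'_def by linarith
  qed
  have ftc: "((\<lambda>s. if s < t then g' s else 0) has_integral g t - g (-1)) {-1..1}" if "t \<in> {-1..1}" for t
  proof -
    have "(g' has_integral g t - g (-1)) {-1..t}"
      using that by (intro fundamental_theorem_of_calculus)
        (auto simp: has_real_derivative_iff_has_vector_derivative[symmetric]
              intro!: DERIV_subset[OF dg])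
    then have "((\<lambda>s. if s \<in> {-1..t} then g' s else 0) has_integral g t - g (-1)) {-1..1}"
      by (subst has_integral_restrict) (use that in auto)
    then show ?thesis
      by (rule has_integral_spike_finite[where S = "{t}", rotated 2]) auto
  qed
  define c where "c = (\<lambda>s. real (card {m \<in> S. s < T (node M \<delta> m)}))"
  have "((\<lambda>s. \<Sum>m\<in>S. if s < T (node M \<delta> m) then g' s else 0) has_integral
            (\<Sum>m\<in>S. g (T (node M \<delta> m)) - g (-1))) {-1..1}"
    by (intro has_integral_sum finS ftc) (use inv1 in \<open>force simp: S_def\<close>)
  moreover have "(\<Sum>m\<in>S. if s < T (node M \<delta> m) then g' s else 0) = g' s * c s" for s
    by (simp only: c_def sum.If_cases[OF finS] Int_def sum_constant sum.neutral_const mem_Collect_eq) simp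
  moreover have "g (T (node M \<delta> m)) = T (node M \<delta> m) ^ k * node M \<delta> m ^ l" if "m \<in> S" for m
    using inv1[of "node M \<delta> m"] that by (simp add: S_def g_def)
  ultimately have sum_int: "((\<lambda>s. g' s * c s) has_integral
       (\<Sum>m\<in>S. T (node M \<delta> m) ^ k * node M \<delta> m ^ l) - real (card S) * g (-1)) {-1..1}"
    by (simp add: sum_subtractf)
  \<comment> \<open>Integration by parts with the antiderivative
    \<open>g s * (\<sigma> * (\<psi> 1 - \<psi> s))\<close>, which vanishes at s = 1; its second
    factor is the length that replaces the node count.\<close>
  have parts: "((\<lambda>s. g' s * (\<sigma> * (\<psi> 1 - \<psi> s))) has_integral
      integral {-1..1} (\<lambda>y. \<sigma> * \<psi>' y * (y ^ k * \<psi> y ^ l)) - (b - a) * g (-1)) {-1..1}"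
  proof -
    have "((\<lambda>s. g' s * (\<sigma> * (\<psi> 1 - \<psi> s)) - \<sigma> * \<psi>' s * g s) has_integral
        g 1 * (\<sigma> * (\<psi> 1 - \<psi> 1)) - g (-1) * (\<sigma> * (\<psi> 1 - \<psi> (-1)))) {-1..1}"
      by (rule fundamental_theorem_of_calculus)
        (auto simp: has_real_derivative_iff_has_vector_derivative[symmetric] algebra_simps
              intro!: derivative_eq_intros dg der)
    moreover have "((\<lambda>s. \<sigma> * \<psi>' s * g s) has_integral integral {-1..1} (\<lambda>s. \<sigma> * \<psi>' s * g s)) {-1..1}"
      unfolding g_def by (intro integrable_integral integrable_continuous_interval continuous_intros cont cont\<psi>)
    ultimately have "((\<lambda>s. (g' s * (\<sigma> * (\<psi> 1 - \<psi> s)) - \<sigma> * \<psi>' s * g s) + \<sigma> * \<psi>' s * g s) has_integral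
        (g 1 * (\<sigma> * (\<psi> 1 - \<psi> 1)) - g (-1) * (\<sigma> * (\<psi> 1 - \<psi> (-1)))) + integral {-1..1} (\<lambda>s. \<sigma> * \<psi>' s * g s)) {-1..1}"
      by (rule has_integral_add)
    then show ?thesis unfolding endpoints by (simp add: g_def mult.commute)
  qed
  define D where "D = 2 / real M * (\<Sum>m\<in>S. T (node M \<delta> m) ^ k * node M \<delta> m ^ l)
            - integral {-1..1} (\<lambda>y. \<sigma> * \<psi>' y * (y ^ k * \<psi> y ^ l))"
  \<comment> \<open>The boundary term at -1: the count of all nodes in the branch interval against
    the length of that interval.\<close>
  define e where "e = (2 / real M * real (card S) - (b - a)) * g (-1)"
  have "((\<lambda>s. g' s * (2 / real M * c s - \<sigma> * (\<psi> 1 - \<psi> s))) has_integral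
     D - e) {-1..1}"
    using has_integral_diff[OF has_integral_mult_right[OF sum_int, of "2 / real M"] parts]
    by (simp add: D_def e_def algebra_simps)
  moreover have "((\<lambda>s. 2 / real M * (real k + real l * (\<sigma> * \<psi>' s))) has_integral
     2 / real M * (real k * 2 + real l * (b - a))) {-1..1}"
  proof -
    have "((\<lambda>s. \<sigma> * \<psi>' s) has_integral b - a) {-1..1}"
      unfolding endpoints[symmetric] right_diff_distrib by (rule fundamental_theorem_of_calculus)
        (auto simp: has_real_derivative_iff_has_vector_derivative[symmetric]
              intro!: derivative_eq_intros der)
    moreover have "((\<lambda>s. real k) has_integral real k * 2) {-1..1::real}"
      using has_integral_const_real[of "real k" "-1" 1] by (simp add: mult.commute)
    ultimately show ?thesis
      by (intro has_integral_mult_right has_integral_add)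
  qed
  ultimately have bnd: "\<bar>D - e\<bar> \<le>
     2 / real M * (real k * 2 + real l * (b - a))"
  proof -
    assume 1: "((\<lambda>s. g' s * (2 / real M * c s - \<sigma> * (\<psi> 1 - \<psi> s))) has_integral
        D - e) {-1..1}"
      and 2: "((\<lambda>s. 2 / real M * (real k + real l * (\<sigma> * \<psi>' s))) has_integral
        2 / real M * (real k * 2 + real l * (b - a))) {-1..1}"
    have "norm (g' s * (2 / real M * c s - \<sigma> * (\<psi> 1 - \<psi> s)))
        \<le> 2 / real M * (real k + real l * (\<sigma> * \<psi>' s))" if "s \<in> {-1..1}" for s
      using mult_mono[OF g'_le[OF that] h_le[OF that]] pos'[OF that]
      by (simp add: abs_mult c_def mult.commute)
    then show ?thesis
      unfolding real_norm_def[symmetric]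
        integral_unique[OF 1, symmetric] integral_unique[OF 2, symmetric]
      by (intro integral_norm_bound_integral has_integral_integrable[OF 1] has_integral_integrable[OF 2])
  qed
  moreover have "\<bar>e\<bar> \<le> 2 / real M * 1"
  proof -
    have "\<bar>g (-1)\<bar> \<le> 1 * 1"
      unfolding g_def abs_mult by (intro mult_mono abs1) auto
    moreover have "\<bar>2 / real M * real (card S) - (b - a)\<bar> \<le> 2 / real M"
      using card_nodes_open_interval[OF M \<delta>, of a b] ab by (auto simp: S_def)
    ultimately show ?thesis unfolding e_def abs_mult by (intro mult_mono) auto
  qed
  moreover have "2 / real M * (real l * (b - a)) \<le> 2 / real M * (real l * 2)"
    using ab by (intro mult_left_mono) auto
  ultimately have "\<bar>D\<bar> \<le> 2 / real M * 1 + 2 / real M * (real k * 2) + 2 / real M * (real l * 2)"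
    unfolding distrib_left by linarith
  then show ?thesis by (simp add: D_def S_def algebra_simps)
qed

section \<open>Summation over finitely many monotone branches\<close>

locale real_branches =
  fixes T :: "real \<Rightarrow> real" and d :: nat and a b :: "nat \<Rightarrow> real"
    and \<psi> \<psi>' :: "nat \<Rightarrow> real \<Rightarrow> real" and \<sigma> :: "nat \<Rightarrow> real"
  assumes T_range: "\<And>x. x \<in> {-1..1} \<Longrightarrow> T x \<in> {-1..1}"
    and intervals: "\<And>i. i < d \<Longrightarrow> -1 \<le> a i \<and> a i < b i \<and> b i \<le> 1"
    and cover: "(\<Union>i<d. {a i..b i}) = {-1..1}"
    and disjoint: "\<And>i j. i < d \<Longrightarrow> j < d \<Longrightarrow> i \<noteq> j \<Longrightarrow> {a i<..<b i} \<inter> {a j<..<b j} = {}"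
    and der: "\<And>i y. i < d \<Longrightarrow> y \<in> {-1..1} \<Longrightarrow> (\<psi> i has_real_derivative \<psi>' i y) (at y within {-1..1})"
    and cont: "\<And>i. i < d \<Longrightarrow> continuous_on {-1..1} (\<psi>' i)"
    and sign: "\<And>i. i < d \<Longrightarrow> \<sigma> i = 1 \<or> \<sigma> i = -1"
    and pos: "\<And>i y. i < d \<Longrightarrow> y \<in> {-1<..<1} \<Longrightarrow> \<sigma> i * \<psi>' i y > 0"
    and inv1: "\<And>i x. i < d \<Longrightarrow> x \<in> {a i<..<b i} \<Longrightarrow> T x \<in> {-1<..<1} \<and> \<psi> i (T x) = x"
    and inv2: "\<And>i y. i < d \<Longrightarrow> y \<in> {-1<..<1} \<Longrightarrow> \<psi> i y \<in> {a i<..<b i} \<and> T (\<psi> i y) = y"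
begin

text \<open>The nodes in no open branch interval are endpoints of branches, at most 2d of them
  because nodes are distinct, and each contributes at most 1 whatever value T takes there. These
  terms raise the 1 of \<open>branch_quadrature\<close> to 3.\<close>

lemma quadrature:
  assumes M: "1 \<le> M" and \<delta>: "0 \<le> \<delta>" "\<delta> \<le> 2 / real M"
  shows "\<bar>(\<Sum>m<M. T (node M \<delta> m) ^ k * node M \<delta> m ^ l) / real M
           - (\<Sum>i<d. integral {-1..1} (\<lambda>y. \<sigma> i * \<psi>' i y * (y ^ k * \<psi> i y ^ l))) / 2\<bar>
         \<le> real d / real M * (3 + 2 * real k + 2 * real l)"
proof -
  define F where "F = (\<lambda>m. T (node M \<delta> m) ^ k * node M \<delta> m ^ l)"
  define S where "S = (\<lambda>i. {m. m < M \<and> node M \<delta> m \<in> {a i<..<b i}})"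
  define J where "J = (\<lambda>i. integral {-1..1} (\<lambda>y. \<sigma> i * \<psi>' i y * (y ^ k * \<psi> i y ^ l)))"
  define Z where "Z = {..<M} - (\<Union>i<d. S i)"
  have S_sub: "(\<Union>i<d. S i) \<subseteq> {..<M}" by (auto simp: S_def)
  have F_le: "\<bar>F m\<bar> \<le> 1" if "m < M" for m
  proof -
    have "node M \<delta> m \<in> {-1..1}" by (rule node_in_range[OF that \<delta>])
    moreover from this have "T (node M \<delta> m) \<in> {-1..1}" by (rule T_range)
    ultimately have "\<bar>F m\<bar> \<le> 1 * 1"
      unfolding F_def abs_mult power_abs by (intro mult_mono power_le_one) auto
    then show ?thesis by simp
  qed
  have "node M \<delta> ` Z \<subseteq> a ` {..<d} \<union> b ` {..<d}"
  proof
    fix x assume "x \<in> node M \<delta> ` Z"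
    then obtain m where m: "m \<in> Z" "x = node M \<delta> m" by auto
    then have "x \<in> (\<Union>i<d. {a i..b i})"
      unfolding cover using node_in_range[OF _ \<delta>, of m] by (simp add: Z_def)
    then obtain i where i: "i < d" "a i \<le> x" "x \<le> b i" by auto
    have "m \<notin> S i" using m i by (auto simp: Z_def)
    then have "\<not> (a i < x \<and> x < b i)" using m by (auto simp: S_def Z_def)
    then have "x = a i \<or> x = b i" using i by auto
    then show "x \<in> a ` {..<d} \<union> b ` {..<d}" using i by auto
  qed
  then have "card (node M \<delta> ` Z) \<le> card (a ` {..<d} \<union> b ` {..<d})"
    by (intro card_mono) auto
  also have "\<dots> \<le> card (a ` {..<d}) + card (b ` {..<d})" by (rule card_Un_le)
  also have "\<dots> \<le> d + d" by (intro add_mono) (metis card_image_le card_lessThan finite_lessThan)+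
  also have "card (node M \<delta> ` Z) = card Z"
    by (intro card_image inj_on_subset[OF inj_on_node]) (auto simp: Z_def)
  finally have cardZ: "real (card Z) \<le> 2 * real d" by linarith
  have "(\<Sum>m<M. F m) = (\<Sum>m\<in>(\<Union>i<d. S i). F m) + (\<Sum>m\<in>Z. F m)"
    unfolding Z_def using sum.subset_diff[OF S_sub, of F] by simp
  also have "(\<Sum>m\<in>(\<Union>i<d. S i). F m) = (\<Sum>i<d. \<Sum>m\<in>S i. F m)"
  proof (rule sum.UNION_disjoint)
    show "\<forall>i\<in>{..<d}. \<forall>j\<in>{..<d}. i \<noteq> j \<longrightarrow> S i \<inter> S j = {}"
    proof (intro ballI impI)
      fix i j
      assume "i \<in> {..<d}" "j \<in> {..<d}" "i \<noteq> j"
      then have "{a i<..<b i} \<inter> {a j<..<b j} = {}" by (intro disjoint) auto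
      then show "S i \<inter> S j = {}" unfolding S_def by blast
    qed
  qed (auto simp: S_def)
  finally have "2 / real M * (\<Sum>m<M. F m) - (\<Sum>i<d. J i) =
      (\<Sum>i<d. 2 / real M * (\<Sum>m\<in>S i. F m) - J i) + 2 / real M * (\<Sum>m\<in>Z. F m)"
    by (simp only: sum_subtractf sum_distrib_left[symmetric] distrib_left)
  also have "\<bar>\<dots>\<bar> \<le> (\<Sum>i<d. 2 / real M * (1 + 2 * real k + 2 * real l)) + 2 / real M * (2 * real d)"
  proof (rule order_trans[OF abs_triangle_ineq add_mono])
    show "\<bar>\<Sum>i<d. 2 / real M * (\<Sum>m\<in>S i. F m) - J i\<bar> \<le> (\<Sum>i<d. 2 / real M * (1 + 2 * real k + 2 * real l))"
    proof (rule order_trans[OF sum_abs sum_mono])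
      fix i assume "i \<in> {..<d}"
      then have i: "i < d" by simp
      show "\<bar>2 / real M * (\<Sum>m\<in>S i. F m) - J i\<bar> \<le> 2 / real M * (1 + 2 * real k + 2 * real l)"
        unfolding S_def F_def J_def
        using intervals[OF i] der[OF i] cont[OF i] sign[OF i] pos[OF i] inv1[OF i] inv2[OF i]
        by (intro branch_quadrature M \<delta>) blast+
    qed
    have "\<bar>\<Sum>m\<in>Z. F m\<bar> \<le> (\<Sum>m\<in>Z. 1)"
      by (rule order_trans[OF sum_abs sum_mono]) (use F_le in \<open>auto simp: Z_def\<close>)
    then have "\<bar>\<Sum>m\<in>Z. F m\<bar> \<le> 2 * real d" using cardZ by simp
    then show "\<bar>2 / real M * (\<Sum>m\<in>Z. F m)\<bar> \<le> 2 / real M * (2 * real d)"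
      by (simp add: abs_mult divide_right_mono)
  qed
  finally have "\<bar>2 / real M * (\<Sum>m<M. F m) - (\<Sum>i<d. J i)\<bar> \<le> 2 * (real d / real M * (3 + 2 * real k + 2 * real l))"
    by (simp add: distrib_left add_divide_distrib mult_ac)
  moreover have "2 / real M * (\<Sum>m<M. F m) - (\<Sum>i<d. J i) = 2 * ((\<Sum>m<M. F m) / real M - (\<Sum>i<d. J i) / 2)"
    by simp
  ultimately have "\<bar>(\<Sum>m<M. F m) / real M - (\<Sum>i<d. J i) / 2\<bar> \<le> real d / real M * (3 + 2 * real k + 2 * real l)"
    by (simp only: abs_mult) simp
  then show ?thesis by (simp only: F_def J_def)
qed

end

section \<open>Chebyshev polynomials of the second kind\<close>

fun cheb_U :: "nat \<Rightarrow> real poly" where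
  "cheb_U 0 = 1"
| "cheb_U (Suc 0) = [:0, 2:]"
| "cheb_U (Suc (Suc n)) = Polynomial.smult 2 (pCons 0 (cheb_U (Suc n))) - cheb_U n"

lemma coeff_cheb_U_above: "n < i \<Longrightarrow> coeff (cheb_U n) i = 0"
proof (induction n arbitrary: i rule: cheb_U.induct)
  case (3 n)
  then show ?case by (cases i) auto
qed (auto simp: coeff_pCons split: nat.splits)

lemma coeff_cheb_U_lead: "coeff (cheb_U n) n = 2 ^ n"
  by (induction n rule: cheb_U.induct) (auto simp: coeff_cheb_U_above)

lemma poly_cheb_U_cos: "poly (cheb_U n) (cos t) * sin t = sin (real (Suc n) * t)"
proof (induction n rule: cheb_U.induct)
  case 2
  then show ?case by (simp add: sin_double)
next
  case (3 n)
  define u where "u = real (Suc (Suc n)) * t"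
  have "sin (u + t) = 2 * cos t * sin u - sin (u - t)"
    by (simp add: sin_add sin_diff)
  moreover have "u + t = real (Suc (Suc (Suc n))) * t" "u - t = real (Suc n) * t"
    by (simp_all add: u_def algebra_simps)
  ultimately have "sin (real (Suc (Suc (Suc n))) * t) = 2 * cos t * sin u - sin (real (Suc n) * t)"
    by simp
  with 3 show ?case by (simp add: u_def algebra_simps)
qed simp

text \<open>The growth rate $1+\sqrt2$ is the positive root of $g^2=2g+1$, the recursion of
  \<^const>\<open>cheb_U\<close> with all signs made positive.\<close>
lemma sum_abs_coeff_cheb_U: "(\<Sum>i<K. \<bar>coeff (cheb_U n) i\<bar>) \<le> (1 + sqrt 2) ^ n"
proof (induction n rule: cheb_U.induct)
  case 1
  have "(\<Sum>i<K. \<bar>coeff (cheb_U 0) i\<bar>) = (\<Sum>i<K. if i = 0 then 1 else 0)"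
    by (intro sum.cong) (auto simp: one_pCons coeff_pCons split: nat.splits)
  then show ?case by (simp add: sum.delta)
next
  case 2
  have "(\<Sum>i<K. \<bar>coeff (cheb_U (Suc 0)) i\<bar>) = (\<Sum>i<K. if i = 1 then 2 else 0)"
    by (intro sum.cong) (auto simp: coeff_pCons split: nat.splits)
  moreover have "1 \<le> sqrt 2" by simp
  ultimately show ?case by (simp add: sum.delta)
next
  case (3 n)
  define g where "g = 1 + sqrt 2"
  have g: "g ^ 2 = 2 * g + 1" by (simp add: g_def power2_eq_square algebra_simps)
  \<comment> \<open>Multiplication by x shifts the coefficients, so the truncated sum may lose its
    top term but gains nothing.\<close>
  have shift: "(\<Sum>i<K. \<bar>coeff (pCons 0 p) i\<bar>) \<le> (\<Sum>i<K. \<bar>coeff p i\<bar>)" for p :: "real poly"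
    by (cases K) (simp_all add: sum.lessThan_Suc_shift[of "\<lambda>i. \<bar>coeff (pCons 0 p) i\<bar>"] del: sum.lessThan_Suc
        , simp)
  have "(\<Sum>i<K. \<bar>coeff (cheb_U (Suc (Suc n))) i\<bar>)
      \<le> (\<Sum>i<K. 2 * \<bar>coeff (pCons 0 (cheb_U (Suc n))) i\<bar> + \<bar>coeff (cheb_U n) i\<bar>)"
  proof (rule sum_mono)
    fix i
    show "\<bar>coeff (cheb_U (Suc (Suc n))) i\<bar> \<le> 2 * \<bar>coeff (pCons 0 (cheb_U (Suc n))) i\<bar> + \<bar>coeff (cheb_U n) i\<bar>"
      unfolding cheb_U.simps coeff_diff coeff_smult by linarith
  qed
  also have "\<dots> = 2 * (\<Sum>i<K. \<bar>coeff (pCons 0 (cheb_U (Suc n))) i\<bar>) + (\<Sum>i<K. \<bar>coeff (cheb_U n) i\<bar>)"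
    by (simp add: sum.distrib sum_distrib_left)
  also have "\<dots> \<le> 2 * g ^ Suc n + g ^ n"
    using 3 shift[of "cheb_U (Suc n)"] unfolding g_def by linarith
  also have "\<dots> = g ^ n * g ^ 2" unfolding g by (simp add: algebra_simps)
  also have "\<dots> = g ^ Suc (Suc n)" by (simp add: power2_eq_square)
  finally show ?case by (simp add: g_def)
qed

text \<open>The leading coefficient 2^N is nonzero, so a multiple of \<open>cheb_U N\<close> cancels
  the top coefficient and the degree drops.\<close>

lemma cheb_U_expansion:
  fixes p :: "real poly"
  assumes "\<forall>i\<ge>N. coeff p i = 0"
  obtains b where "p = (\<Sum>n<N. Polynomial.smult (b n) (cheb_U n))"
  using assms
proof (induction N arbitrary: p thesis)
  case 0
  then show ?case by (simp add: poly_eq_iff)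
next
  case (Suc N)
  define q where "q = p - Polynomial.smult (coeff p N / 2 ^ N) (cheb_U N)"
  have "coeff q i = 0" if "N \<le> i" for i
    using that Suc.prems(2) coeff_cheb_U_above[of N i] coeff_cheb_U_lead[of N]
    by (cases "i = N") (auto simp: q_def)
  then obtain b where b: "q = (\<Sum>n<N. Polynomial.smult (b n) (cheb_U n))"
    using Suc.IH by blast
  have "p = (\<Sum>n<Suc N. Polynomial.smult ((b(N := coeff p N / 2 ^ N)) n) (cheb_U n))"
    using b by (simp add: q_def algebra_simps)
  then show ?case by (rule Suc.prems(1))
qed

lemma integral_sin_sin:
  "((\<lambda>t. sin (real (Suc m) * t) * sin (real (Suc n) * t)) has_integral (if m = n then pi / 2 else 0)) {0..pi}"
proof -
  have cosint: "((\<lambda>t. cos (c * t)) has_integral 0) {0..pi}" if "c \<in> \<int>" "c \<noteq> 0" for c :: real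
  proof -
    have "((\<lambda>t. cos (c * t)) has_integral sin (c * pi) / c - sin (c * 0) / c) {0..pi}"
      using that by (intro fundamental_theorem_of_calculus)
        (auto simp: has_real_derivative_iff_has_vector_derivative[symmetric] intro!: derivative_eq_intros)
    moreover have "sin (c * pi) = 0"
      using that(1) by (metis mult.commute sin_times_pi_eq_0)
    ultimately show ?thesis by simp
  qed
  have plus: "((\<lambda>t. cos (real (Suc m + Suc n) * t)) has_integral 0) {0..pi}"
    by (rule cosint) (simp_all del: of_nat_Suc of_nat_add)
  have minus: "((\<lambda>t. cos ((real m - real n) * t)) has_integral (if m = n then pi else 0)) {0..pi}"
  proof (cases "m = n")
    case True
    then show ?thesis using has_integral_const_real[of "1::real" 0 pi] by simp
  next
    case False
    then show ?thesis using cosint[of "real m - real n"] by simp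
  qed
  have eq: "sin (real (Suc m) * t) * sin (real (Suc n) * t)
      = (cos ((real m - real n) * t) - cos (real (Suc m + Suc n) * t)) / 2" for t
    unfolding sin_times_sin by (simp add: algebra_simps)
  show ?thesis
    unfolding eq using has_integral_divide[OF has_integral_diff[OF minus plus], of 2] by auto
qed

text \<open>Since $\sin t\ge\sin^2t$, the unweighted $L^2$ norm dominates the one for which the
  polynomials \<^const>\<open>cheb_U\<close> are orthogonal.\<close>
lemma sum_cheb_U_le_integral:
  "pi / 2 * (\<Sum>n<N. (b n)\<^sup>2) \<le> integral {-1..1} (\<lambda>x. (poly (\<Sum>n<N. Polynomial.smult (b n) (cheb_U n)) x)\<^sup>2)"
proof -
  define p where "p = (\<Sum>n<N. Polynomial.smult (b n) (cheb_U n))"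
  have psin: "poly p (cos t) * sin t = (\<Sum>n<N. b n * sin (real (Suc n) * t))" for t
    by (simp add: p_def poly_sum sum_distrib_right poly_cheb_U_cos[symmetric] mult.assoc
        del: of_nat_Suc)
  have "((\<lambda>t. \<Sum>m<N. \<Sum>n<N. b m * b n * (sin (real (Suc m) * t) * sin (real (Suc n) * t))) has_integral
        (\<Sum>m<N. \<Sum>n<N. b m * b n * (if m = n then pi / 2 else 0))) {0..pi}"
    by (intro has_integral_sum has_integral_mult_right integral_sin_sin) auto
  moreover have "(\<Sum>m<N. \<Sum>n<N. b m * b n * (if m = n then pi / 2 else 0)) = pi / 2 * (\<Sum>n<N. (b n)\<^sup>2)"
    by (simp add: sum_distrib_left power2_eq_square if_distrib[of "\<lambda>x. _ * x"] cong: if_cong) (simp add: mult_ac)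
  moreover have "(\<Sum>m<N. \<Sum>n<N. b m * b n * (sin (real (Suc m) * t) * sin (real (Suc n) * t)))
       = (poly p (cos t) * sin t)\<^sup>2" for t
    unfolding psin power2_eq_square sum_product by (simp add: mult_ac)
  ultimately have 1: "((\<lambda>t. (poly p (cos t) * sin t)\<^sup>2) has_integral pi / 2 * (\<Sum>n<N. (b n)\<^sup>2)) {0..pi}"
    by simp
  \<comment> \<open>The substitution is by -cos t, which increases on [0,\<pi>] and so gives the
    limits in the right order; the reflection below removes the sign.\<close>
  have "((\<lambda>t. sin t *\<^sub>R (poly p (- (- cos t)))\<^sup>2) has_integral integral {- cos 0..- cos pi} (\<lambda>x. (poly p (- x))\<^sup>2)) {0..pi}"
    by (rule has_integral_substitution[where c = "-1" and d = 1])
      (auto intro!: continuous_intros derivative_eq_intros)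
  moreover have "integral {-1..1} (\<lambda>x. (poly p (- x))\<^sup>2) = integral {-1..1} (\<lambda>x. (poly p x)\<^sup>2)"
    using Henstock_Kurzweil_Integration.integral_reflect_real[of 1 "-1" "\<lambda>x. (poly p x)\<^sup>2"] by simp
  ultimately have 2: "((\<lambda>t. sin t * (poly p (cos t))\<^sup>2) has_integral integral {-1..1} (\<lambda>x. (poly p x)\<^sup>2)) {0..pi}"
    by simp
  have "(poly p (cos t) * sin t)\<^sup>2 \<le> sin t * (poly p (cos t))\<^sup>2" if "t \<in> {0..pi}" for t
  proof -
    have "sin t * sin t \<le> sin t * 1" using that by (intro mult_left_mono) (auto intro: sin_ge_zero)
    then show ?thesis
      by (simp add: power_mult_distrib power2_eq_square[of "sin t"] mult.commute[of "_\<^sup>2"] mult_right_mono)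
  qed
  with has_integral_le[OF 1 2] show ?thesis by (simp add: p_def)
qed

text \<open>A lower bound for the smallest eigenvalue of the Gram matrix. The l^1 norm of the
  coefficients is at most the sum of |b n| g^n over the Chebyshev coefficients b, by
  \<open>sum_abs_coeff_cheb_U\<close>. Cauchy-Schwarz separates b from the powers of g, whose
  squares sum to at most g^(2N) because g \<ge> 2, and orthogonality bounds the sum of squares of
  b.\<close>

lemma sum_coeff_sq_le_integral:
  fixes u :: "nat \<Rightarrow> real"
  shows "(\<Sum>k<N. (u k)\<^sup>2) \<le> (1 + sqrt 2) ^ (2 * N) * integral {-1..1} (\<lambda>x. (\<Sum>k<N. u k * x ^ k)\<^sup>2)"
proof -
  define g where "g = 1 + sqrt 2"
  have g2: "2 \<le> g" unfolding g_def by simp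
  define p where "p = (\<Sum>k<N. monom (u k) k)"
  have coeff_p: "coeff p k = (if k < N then u k else 0)" for k
    by (simp add: p_def coeff_sum if_distrib sum.delta cong: if_cong)
  obtain b where b: "p = (\<Sum>n<N. Polynomial.smult (b n) (cheb_U n))"
    using cheb_U_expansion[of N p] coeff_p by force
  have "(\<Sum>k<N. (u k)\<^sup>2) \<le> (\<Sum>k<N. \<bar>u k\<bar>)\<^sup>2"
  proof -
    have "L2_set u {..<N} \<le> (\<Sum>k<N. \<bar>u k\<bar>)" by (rule L2_set_le_sum_abs)
    then have "(L2_set u {..<N})\<^sup>2 \<le> (\<Sum>k<N. \<bar>u k\<bar>)\<^sup>2" by (intro power_mono) auto
    then show ?thesis by (simp add: L2_set_def sum_nonneg)
  qed
  also have "(\<Sum>k<N. \<bar>u k\<bar>) \<le> (\<Sum>n<N. \<bar>b n\<bar> * g ^ n)"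
  proof -
    have "(\<Sum>k<N. \<bar>u k\<bar>) = (\<Sum>k<N. \<bar>\<Sum>n<N. b n * coeff (cheb_U n) k\<bar>)"
      using coeff_p by (intro sum.cong) (auto simp: b coeff_sum)
    also have "\<dots> \<le> (\<Sum>k<N. \<Sum>n<N. \<bar>b n\<bar> * \<bar>coeff (cheb_U n) k\<bar>)"
      by (intro sum_mono order_trans[OF sum_abs]) (simp add: abs_mult)
    also have "\<dots> = (\<Sum>n<N. \<bar>b n\<bar> * (\<Sum>k<N. \<bar>coeff (cheb_U n) k\<bar>))"
      by (subst sum.swap) (simp add: sum_distrib_left)
    also have "\<dots> \<le> (\<Sum>n<N. \<bar>b n\<bar> * g ^ n)"
      unfolding g_def by (intro sum_mono mult_left_mono sum_abs_coeff_cheb_U) auto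
    finally show ?thesis .
  qed
  then have "(\<Sum>k<N. \<bar>u k\<bar>)\<^sup>2 \<le> (\<Sum>n<N. \<bar>b n\<bar> * g ^ n)\<^sup>2"
    by (intro power_mono) (auto intro: sum_nonneg)
  also have "\<dots> \<le> (\<Sum>n<N. (b n)\<^sup>2) * (\<Sum>n<N. g ^ (2 * n))"
    using Cauchy_Schwarz_ineq_sum[of "\<lambda>n. \<bar>b n\<bar>" "\<lambda>n. g ^ n" "{..<N}"]
    by (simp add: power_mult[symmetric] mult.commute)
  also have "(\<Sum>n<N. g ^ (2 * n)) \<le> g ^ (2 * N)"
  proof (induction N)
    case (Suc N)
    have "(\<Sum>n<Suc N. g ^ (2 * n)) \<le> 2 * g ^ (2 * N)" using Suc by simp
    also have "\<dots> \<le> g ^ 2 * g ^ (2 * N)"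
      using power_mono[OF g2, of 2] by (intro mult_right_mono) (use g2 in auto)
    finally show ?case by (simp add: power_add[symmetric])
  qed simp
  then have "(\<Sum>n<N. (b n)\<^sup>2) * (\<Sum>n<N. g ^ (2 * n)) \<le> (\<Sum>n<N. (b n)\<^sup>2) * g ^ (2 * N)"
    by (intro mult_left_mono) (auto intro: sum_nonneg)
  also have "(\<Sum>n<N. (b n)\<^sup>2) \<le> integral {-1..1} (\<lambda>x. (\<Sum>k<N. u k * x ^ k)\<^sup>2)"
  proof -
    have "1 * (\<Sum>n<N. (b n)\<^sup>2) \<le> pi / 2 * (\<Sum>n<N. (b n)\<^sup>2)"
      using pi_ge_two by (intro mult_right_mono) (auto intro: sum_nonneg)
    also have "\<dots> \<le> integral {-1..1} (\<lambda>x. (poly p x)\<^sup>2)"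
      unfolding b by (rule sum_cheb_U_le_integral)
    also have "poly p = (\<lambda>x. \<Sum>k<N. u k * x ^ k)"
      by (simp add: fun_eq_iff p_def poly_sum poly_monom)
    finally show ?thesis by simp
  qed
  then have "(\<Sum>n<N. (b n)\<^sup>2) * g ^ (2 * N) \<le> integral {-1..1} (\<lambda>x. (\<Sum>k<N. u k * x ^ k)\<^sup>2) * g ^ (2 * N)"
    using g2 by (intro mult_right_mono) auto
  finally show ?thesis by (simp add: g_def mult.commute)
qed

section \<open>Stability of the discrete least squares problem\<close>

text \<open>\<open>block_inverse\<close> is a definite description, so existence and uniqueness are
  both due. A trivial kernel makes the determinant nonzero, which gives a two-sided inverse B. Any
  other candidate B' satisfies B' = B'(AB) = (B'A)B = B on the block, and both vanish outside
  it.\<close>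

lemma block_inverse_correct:
  fixes A :: "nat \<Rightarrow> nat \<Rightarrow> real"
  assumes inj: "\<And>u. (\<And>i. i < N \<Longrightarrow> (\<Sum>j<N. A i j * u j) = 0) \<Longrightarrow> (\<And>j. j < N \<Longrightarrow> u j = 0)"
    and ij: "i < N" "j < N"
  shows "(\<Sum>k<N. A i k * block_inverse N A k j) = (if i = j then 1 else 0)"
proof -
  define P where "P = (\<lambda>B. (\<forall>i j. (N \<le> i \<or> N \<le> j) \<longrightarrow> B i j = 0) \<and>
      (\<forall>i<N. \<forall>j<N. (\<Sum>k<N. A i k * B k j) = (if i = j then 1 else (0::real))) \<and>
      (\<forall>i<N. \<forall>j<N. (\<Sum>k<N. B i k * A k j) = (if i = j then 1 else (0::real))))"
  define \<A> where "\<A> = mat N N (\<lambda>(i, j). A i j)"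
  have \<A>: "\<A> \<in> carrier_mat N N" by (simp add: \<A>_def)
  have "det \<A> \<noteq> 0"
  proof
    assume "det \<A> = 0"
    then obtain v where v: "v \<in> carrier_vec N" "v \<noteq> 0\<^sub>v N" "\<A> *\<^sub>v v = 0\<^sub>v N"
      using det_0_iff_vec_prod_zero_field[OF \<A>] by blast
    have "(\<Sum>j<N. A i j * vec_index v j) = 0" if "i < N" for i
    proof -
      have "(\<Sum>j<N. A i j * vec_index v j) = vec_index (\<A> *\<^sub>v v) i"
        using that v(1) by (simp add: \<A>_def scalar_prod_def row_def atLeast0LessThan)
      then show ?thesis using v(3) that by simp
    qed
    then have "vec_index v j = 0" if "j < N" for j using inj that by blast
    then have "v = 0\<^sub>v N" using v(1) by (intro eq_vecI) auto
    then show False using v(2) by simp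
  qed
  \<comment> \<open>\<open>undefined\<close> only fills the record extension of
    \<open>ring_mat\<close>; the units do not depend on it.\<close>
  then obtain \<B> where \<B>: "\<B> \<in> carrier_mat N N" "\<A> * \<B> = 1\<^sub>m N" "\<B> * \<A> = 1\<^sub>m N"
    using det_non_zero_imp_unit[OF \<A>, of undefined] unfolding Units_def ring_mat_def by auto
  define B where "B = (\<lambda>i j. if i < N \<and> j < N then \<B> $$ (i, j) else 0)"
  have "P B"
  proof -
    have "(\<Sum>k<N. A i k * B k j) = (if i = j then 1 else 0)" if "i < N" "j < N" for i j
    proof -
      have "(\<Sum>k<N. A i k * B k j) = (\<A> * \<B>) $$ (i, j)"
        using that \<B>(1) by (simp add: \<A>_def B_def scalar_prod_def row_def col_def atLeast0LessThan)
      then show ?thesis using that \<B>(2) by simp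
    qed
    moreover have "(\<Sum>k<N. B i k * A k j) = (if i = j then 1 else 0)" if "i < N" "j < N" for i j
    proof -
      have "(\<Sum>k<N. B i k * A k j) = (\<B> * \<A>) $$ (i, j)"
        using that \<B>(1) by (simp add: \<A>_def B_def scalar_prod_def row_def col_def atLeast0LessThan)
      then show ?thesis using that \<B>(3) by simp
    qed
    ultimately show ?thesis unfolding P_def by (simp add: B_def)
  qed
  moreover have "B' = B" if B': "P B'" for B'
  proof (intro ext)
    fix i j
    show "B' i j = B i j"
    proof (cases "i < N \<and> j < N")
      case True
      have "B' i j = (\<Sum>k<N. B' i k * (if k = j then 1 else 0))"
        using True by (simp add: if_distrib sum.delta cong: if_cong)
      also have "\<dots> = (\<Sum>k<N. B' i k * (\<Sum>m<N. A k m * B m j))"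
        using \<open>P B\<close> True unfolding P_def by (intro sum.cong) auto
      also have "\<dots> = (\<Sum>m<N. (\<Sum>k<N. B' i k * A k m) * B m j)"
        unfolding sum_distrib_left sum_distrib_right by (subst sum.swap) (simp add: mult.assoc)
      also have "\<dots> = (\<Sum>m<N. (if i = m then 1 else 0) * B m j)"
        using B' True unfolding P_def by (intro sum.cong) auto
      also have "\<dots> = (\<Sum>m<N. if m = i then B m j else 0)"
        by (intro sum.cong) auto
      also have "\<dots> = B i j"
        using True by simp
      finally show ?thesis .
    next
      case False
      then show ?thesis using B' by (auto simp: P_def B_def)
    qed
  qed
  ultimately have "P (THE B. P B)" by (rule theI)
  moreover have "(THE B. P B) = block_inverse N A"
    unfolding block_inverse_def P_def ..
  ultimately show ?thesis using ij unfolding P_def by auto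
qed

section \<open>The Gram matrix of the monomials and its discretisation\<close>

definition moment :: "nat \<Rightarrow> nat \<Rightarrow> real" where
  "moment k l = integral {-1..1} (\<lambda>y. y ^ k * y ^ l) / 2"

text \<open>The quadratic form of \<open>moment\<close>, see \<open>energy_eq_moment\<close>. The
  division by 2 reflects that nodes of spacing 2/M carry weight 1/M.\<close>

definition energy :: "nat \<Rightarrow> (nat \<Rightarrow> real) \<Rightarrow> real" where
  "energy N u = integral {-1..1} (\<lambda>x. (\<Sum>k<N. u k * x ^ k)\<^sup>2) / 2"

lemma H_mat_moment:
  assumes "1 \<le> M" "0 \<le> \<delta>" "\<delta> \<le> 2 / real M" "k < N" "l < N"
  shows "\<bar>H_mat N M \<delta> k l - moment k l\<bar> \<le> 4 * real N / real M"
proof -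
  \<comment> \<open>The identity is a full branch map with a single branch, so the estimate made for
    \<open>G_mat\<close> also covers \<open>H_mat\<close>.\<close>
  interpret real_branches "\<lambda>x. x" 1 "\<lambda>_. -1" "\<lambda>_. 1" "\<lambda>_ y. y" "\<lambda>_ _. 1" "\<lambda>_. 1"
    by unfold_locales auto
  have "\<bar>H_mat N M \<delta> k l - moment k l\<bar> \<le> real 1 / real M * (3 + 2 * real k + 2 * real l)"
    using quadrature[OF assms(1-3), of k l] assms(4,5) by (simp add: H_mat_def moment_def)
  also have "\<dots> \<le> real 1 / real M * (4 * real N)"
  proof (intro mult_left_mono)
    have "real (Suc k) \<le> real N" "real (Suc l) \<le> real N" using assms by (simp_all del: of_nat_Suc)
    then show "3 + 2 * real k + 2 * real l \<le> 4 * real N" by simp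
  qed simp
  finally show ?thesis by simp
qed

lemma energy_eq_moment: "energy N u = (\<Sum>k<N. \<Sum>l<N. u k * u l * moment k l)"
proof -
  have "((\<lambda>x. \<Sum>k<N. \<Sum>l<N. u k * u l * (x ^ k * x ^ l)) has_integral
      (\<Sum>k<N. \<Sum>l<N. u k * u l * integral {-1..1} (\<lambda>x. x ^ k * x ^ l))) {-1..1}"
    by (intro has_integral_sum has_integral_mult_right integrable_integral
        integrable_continuous_interval continuous_intros finite_lessThan)
  moreover have "(\<lambda>x. (\<Sum>k<N. u k * x ^ k)\<^sup>2) = (\<lambda>x. \<Sum>k<N. \<Sum>l<N. u k * u l * (x ^ k * x ^ l))"
    unfolding power2_eq_square sum_product by (intro ext sum.cong refl) (simp add: mult_ac)
  ultimately show ?thesis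
    by (simp add: energy_def moment_def integral_unique sum_divide_distrib)
qed

lemma energy_nonneg: "0 \<le> energy N u"
  unfolding energy_def by (auto intro!: integral_nonneg integrable_continuous_interval continuous_intros)

lemma sum_sq_le_energy: "(\<Sum>k<N. (u k)\<^sup>2) \<le> 2 * (1 + sqrt 2) ^ (2 * N) * energy N u"
  using sum_coeff_sq_le_integral[of u N] by (simp add: energy_def)

text \<open>The entrywise error 4N/M changes the quadratic form by at most 4N/M times the squared
  l^1 norm of u, hence by 4N^2/M times its squared l^2 norm, hence by 8N^2 (1 + sqrt 2)^(2N)/M times
  the energy. The constant 16 makes this at most half the energy.\<close>

lemma H_mat_coercive:
  assumes M: "1 \<le> M" and \<delta>: "0 \<le> \<delta>" "\<delta> \<le> 2 / real M"
    and large: "16 * (real N)\<^sup>2 * (1 + sqrt 2) ^ (2 * N) \<le> real M"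
  shows "energy N u \<le> 2 * (\<Sum>k<N. u k * (\<Sum>l<N. H_mat N M \<delta> k l * u l))"
proof -
  define Q where "Q = (\<Sum>k<N. u k * (\<Sum>l<N. H_mat N M \<delta> k l * u l))"
  have "energy N u - Q = (\<Sum>k<N. \<Sum>l<N. u k * u l * (moment k l - H_mat N M \<delta> k l))"
    unfolding energy_eq_moment Q_def sum_distrib_left sum_subtractf[symmetric] by (simp add: algebra_simps)
  also have "\<dots> \<le> (\<Sum>k<N. \<Sum>l<N. \<bar>u k\<bar> * \<bar>u l\<bar> * (4 * real N / real M))"
  proof (intro sum_mono)
    fix k l assume kl: "k \<in> {..<N}" "l \<in> {..<N}"
    have "u k * u l * (moment k l - H_mat N M \<delta> k l) \<le> \<bar>u k\<bar> * \<bar>u l\<bar> * \<bar>H_mat N M \<delta> k l - moment k l\<bar>"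
      unfolding abs_mult[symmetric] abs_minus_commute[of "H_mat N M \<delta> k l"] abs_mult[symmetric]
      by (rule abs_ge_self)
    also have "\<dots> \<le> \<bar>u k\<bar> * \<bar>u l\<bar> * (4 * real N / real M)"
      using H_mat_moment[OF M \<delta>] kl by (intro mult_left_mono) auto
    finally show "u k * u l * (moment k l - H_mat N M \<delta> k l) \<le> \<bar>u k\<bar> * \<bar>u l\<bar> * (4 * real N / real M)" .
  qed
  also have "\<dots> = 4 * real N / real M * (\<Sum>k<N. \<bar>u k\<bar>)\<^sup>2"
    by (simp add: power2_eq_square sum_product sum_distrib_left mult_ac)
  also have "\<dots> \<le> 4 * real N / real M * ((\<Sum>k<N. (u k)\<^sup>2) * real N)"
    using sum_squared_le_sum_of_squares[of "\<lambda>k. \<bar>u k\<bar>" "{..<N}"] by (intro mult_left_mono) auto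
  also have "\<dots> \<le> 4 * real N / real M * ((2 * (1 + sqrt 2) ^ (2 * N) * energy N u) * real N)"
    by (intro mult_left_mono mult_right_mono sum_sq_le_energy) auto
  also have "\<dots> = (16 * (real N)\<^sup>2 * (1 + sqrt 2) ^ (2 * N)) / real M * (energy N u / 2)"
    by (simp add: power2_eq_square)
  also have "\<dots> \<le> 1 * (energy N u / 2)"
    using large M energy_nonneg[of N u] by (intro mult_right_mono) auto
  finally show ?thesis by (simp add: Q_def)
qed

text \<open>By coercivity a vector in the kernel has zero energy, hence zero coefficients.\<close>

lemma H_mat_block_inverse:
  assumes "1 \<le> M" "0 \<le> \<delta>" "\<delta> \<le> 2 / real M"
    and "16 * (real N)\<^sup>2 * (1 + sqrt 2) ^ (2 * N) \<le> real M"
    and "i < N" "j < N"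
  shows "(\<Sum>k<N. H_mat N M \<delta> i k * block_inverse N (H_mat N M \<delta>) k j) = (if i = j then 1 else 0)"
proof (rule block_inverse_correct[OF _ assms(5,6)])
  fix u j assume u: "\<And>i. i < N \<Longrightarrow> (\<Sum>j<N. H_mat N M \<delta> i j * u j) = 0" and j: "j < N"
  have "energy N u \<le> 0" using H_mat_coercive[OF assms(1-4), of u] u by simp
  then have "(\<Sum>k<N. (u k)\<^sup>2) \<le> 0"
    using sum_sq_le_energy[of u N] energy_nonneg[of N u] by simp
  then have "(\<Sum>k<N. (u k)\<^sup>2) = 0" by (intro antisym sum_nonneg) auto
  then show "u j = 0" using j by (simp add: sum_nonneg_eq_0_iff)
qed

text \<open>A right-hand side that comes from a function on $[-1,1]$ only costs the square root of the
  norm of the inverse.\<close>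
lemma least_squares_stability:
  assumes M: "1 \<le> M" "0 \<le> \<delta>" "\<delta> \<le> 2 / real M"
    and large: "16 * (real N)\<^sup>2 * (1 + sqrt 2) ^ (2 * N) \<le> real M"
    and eq: "\<And>k. k < N \<Longrightarrow> (\<Sum>l<N. H_mat N M \<delta> k l * u l) = w k + integral {-1..1} (\<lambda>x. x ^ k * q x) / 2"
    and q: "continuous_on {-1..1} q" "\<And>x. x \<in> {-1..1} \<Longrightarrow> \<bar>q x\<bar> \<le> S"
  shows "L2_set u {..<N} \<le> 5 * (1 + sqrt 2) ^ (2 * N) * L2_set w {..<N} + 3 * (1 + sqrt 2) ^ N * S"
proof -
  define g where "g = 1 + sqrt 2"
  define e where "e = sqrt (energy N u)"
  define p where "p = (\<lambda>x. \<Sum>k<N. u k * x ^ k)"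
  define U where "U = L2_set u {..<N}"
  define W where "W = L2_set w {..<N}"
  have g: "0 < g ^ n" for n unfolding g_def by (intro zero_less_power) (simp add: add_pos_pos)
  have W: "0 \<le> W" unfolding W_def by (rule L2_set_nonneg)
  have S: "0 \<le> S" using q(2)[of 0] by simp
  have e0: "0 \<le> e" unfolding e_def using energy_nonneg by simp
  have e2: "e\<^sup>2 = energy N u" unfolding e_def using energy_nonneg by simp
  \<comment> \<open>The factor 3/2 stands in for sqrt 2.\<close>
  have U_le: "U \<le> 3 / 2 * g ^ N * e"
  proof (rule power2_le_imp_le)
    have "U\<^sup>2 = (\<Sum>k<N. (u k)\<^sup>2)" unfolding U_def L2_set_def by (simp add: sum_nonneg)
    also have "\<dots> \<le> 2 * (g ^ N)\<^sup>2 * e\<^sup>2"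
      using sum_sq_le_energy[of u N] unfolding e2 g_def by (simp add: power_mult[symmetric] mult.commute)
    also have "\<dots> \<le> 9 / 4 * (g ^ N)\<^sup>2 * e\<^sup>2" by (intro mult_right_mono) auto
    also have "\<dots> = (3 / 2 * g ^ N * e)\<^sup>2" by (simp add: power_mult_distrib power2_eq_square)
    finally show "U\<^sup>2 \<le> (3 / 2 * g ^ N * e)\<^sup>2" .
    show "0 \<le> 3 / 2 * g ^ N * e" using g e0 by (simp add: less_imp_le)
  qed
  have contp: "continuous_on {-1..1} p" unfolding p_def by (intro continuous_intros)
  have "e \<le> 3 * g ^ N * W + 2 * S"
  proof (cases "e = 0")
    case True
    then show ?thesis using g[of N] W S by (simp add: less_imp_le)
  next
    case False
    then have e: "0 < e" using e0 by simp
    have "(\<Sum>k<N. u k * w k) \<le> U * W"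
      unfolding U_def W_def by (intro order_trans[OF _ L2_set_mult_ineq] sum_mono) (simp add: abs_mult[symmetric])
    moreover have "integral {-1..1} (\<lambda>x. p x * q x) / 2 \<le> S * e"
    proof -
      \<comment> \<open>A weighted arithmetic-geometric mean inequality plays the part of
        Cauchy-Schwarz for integrals: p^2 has integral 2e^2, so with weight e the integral of |p| is
        at most 2e.\<close>
      have le: "p x * q x \<le> S / 2 * ((p x)\<^sup>2 / e + e)" if "x \<in> {-1..1}" for x
      proof -
        have "p x * q x \<le> \<bar>p x\<bar> * \<bar>q x\<bar>" by (metis abs_ge_self abs_mult)
        also have "\<dots> \<le> \<bar>p x\<bar> * S" using q(2)[OF that] by (intro mult_left_mono) auto
        also have "2 * \<bar>p x\<bar> * e \<le> (p x)\<^sup>2 + e\<^sup>2"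
          using sum_squares_bound[of "\<bar>p x\<bar>" e] by simp
        then have "\<bar>p x\<bar> \<le> ((p x)\<^sup>2 / e + e) / 2"
          using e by (simp add: field_simps power2_eq_square)
        then have "\<bar>p x\<bar> * S \<le> ((p x)\<^sup>2 / e + e) / 2 * S" using S by (intro mult_right_mono)
        finally show ?thesis by (simp only: mult.commute times_divide_eq_right times_divide_eq_left)
      qed
      have int: "((\<lambda>x. S / 2 * ((p x)\<^sup>2 / e + e)) has_integral S / 2 * ((2 * e\<^sup>2) / e + e * 2)) {-1..1}"
      proof -
        have "((\<lambda>x. (p x)\<^sup>2) has_integral 2 * e\<^sup>2) {-1..1}"
          unfolding e2 energy_def p_def
          by (auto intro!: integrable_integral integrable_continuous_interval continuous_intros)
        moreover have "((\<lambda>x. e) has_integral e * 2) {-1..1::real}"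
          using has_integral_const_real[of e "-1" 1] by (simp add: mult.commute)
        ultimately show ?thesis
          by (intro has_integral_mult_right has_integral_add has_integral_divide)
      qed
      have "integral {-1..1} (\<lambda>x. p x * q x) \<le> S / 2 * ((2 * e\<^sup>2) / e + e * 2)"
        using contp q(1) le
        by (intro has_integral_le[OF integrable_integral int] integrable_continuous_interval continuous_intros) auto
      also have "\<dots> = 2 * (S * e)" using e by (simp add: power2_eq_square)
      finally show ?thesis by simp
    qed
    moreover have "e\<^sup>2 \<le> 2 * ((\<Sum>k<N. u k * w k) + integral {-1..1} (\<lambda>x. p x * q x) / 2)"
    proof -
      have "(\<Sum>k<N. u k * (\<Sum>l<N. H_mat N M \<delta> k l * u l))
          = (\<Sum>k<N. u k * w k) + (\<Sum>k<N. u k * integral {-1..1} (\<lambda>x. x ^ k * q x)) / 2"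
        using eq by (simp add: distrib_left sum.distrib sum_divide_distrib)
      also have "(\<Sum>k<N. u k * integral {-1..1} (\<lambda>x. x ^ k * q x)) = integral {-1..1} (\<lambda>x. \<Sum>k<N. u k * (x ^ k * q x))"
        by (subst integral_sum) (auto intro!: integrable_continuous_interval continuous_intros q(1))
      also have "(\<lambda>x. \<Sum>k<N. u k * (x ^ k * q x)) = (\<lambda>x. p x * q x)"
        by (simp add: p_def sum_distrib_right mult.assoc)
      finally show ?thesis
        using H_mat_coercive[OF M large, of u] unfolding e2 by simp
    qed
    ultimately have "e * e \<le> 2 * (U * W) + 2 * (S * e)" by (simp add: power2_eq_square)
    also have "U * W \<le> 3 / 2 * g ^ N * e * W" using U_le W by (rule mult_right_mono)
    finally have "e * e \<le> (3 * g ^ N * W + 2 * S) * e" by (simp add: algebra_simps)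
    then show ?thesis using e by simp
  qed
  then have "3 / 2 * g ^ N * e \<le> 3 / 2 * g ^ N * (3 * g ^ N * W + 2 * S)"
    using g[of N] by (intro mult_left_mono) auto
  also have "\<dots> = 9 / 2 * g ^ (2 * N) * W + 3 * g ^ N * S"
    unfolding mult_2 power_add by (simp add: field_simps)
  also have "\<dots> \<le> 5 * g ^ (2 * N) * W + 3 * g ^ N * S"
    using W g[of "2 * N"] by (intro add_right_mono mult_right_mono) (auto simp: less_imp_le)
  finally show ?thesis using U_le by (simp add: U_def W_def g_def)
qed

section \<open>Taylor coefficients of the transfer operator\<close>

lemma has_real_derivative_Re_Im_of_real:
  assumes "(g has_field_derivative D) (at (complex_of_real y))"
  shows "((\<lambda>x. Re (g (of_real x))) has_real_derivative Re D) (at y within A)"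
    and "((\<lambda>x. Im (g (of_real x))) has_real_derivative Im D) (at y within A)"
proof -
  have "((\<lambda>x. g (of_real x)) has_vector_derivative D) (at y within A)"
    by (rule has_vector_derivative_real_field[OF assms])
  then show "((\<lambda>x. Re (g (of_real x))) has_real_derivative Re D) (at y within A)"
      "((\<lambda>x. Im (g (of_real x))) has_real_derivative Im D) (at y within A)"
    unfolding has_real_derivative_iff_has_vector_derivative
    using bounded_linear.has_vector_derivative[OF bounded_linear_Re]
      bounded_linear.has_vector_derivative[OF bounded_linear_Im] by blast+
qed

text \<open>Along the real segment Im g vanishes identically, and its derivative there is the
  imaginary part of the complex derivative.\<close>

lemma deriv_in_Reals:
  assumes "g holomorphic_on ball 0 R" "1 \<le> R"
    and "\<And>y. y \<in> {-1<..<1} \<Longrightarrow> g (complex_of_real y) \<in> \<real>" and y: "y \<in> {-1<..<1}"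
  shows "deriv g (complex_of_real y) \<in> \<real>"
proof -
  have "(g has_field_derivative deriv g (of_real y)) (at (of_real y))"
    using assms(1,2) y by (intro holomorphic_derivI[of g "ball 0 R"]) auto
  then have "((\<lambda>x. Im (g (of_real x))) has_real_derivative Im (deriv g (of_real y))) (at y)"
    by (rule has_real_derivative_Re_Im_of_real)
  then have "((\<lambda>x. 0) has_real_derivative Im (deriv g (of_real y))) (at y)"
    by (rule has_field_derivative_transform_within_open[where S = "{-1<..<1}"])
      (use assms(3) y in \<open>auto simp: complex_is_Real_iff\<close>)
  then have "Im (deriv g (of_real y)) = 0"
    using DERIV_unique DERIV_const by blast
  then show ?thesis by (simp add: complex_is_Real_iff)
qed

lemma higher_deriv_in_Reals:
  assumes "g holomorphic_on ball 0 R" "1 \<le> R"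
    and "\<And>y. y \<in> {-1<..<1} \<Longrightarrow> g (complex_of_real y) \<in> \<real>" and "y \<in> {-1<..<1}"
  shows "(deriv ^^ n) g (complex_of_real y) \<in> \<real>"
  using assms(4)
proof (induction n arbitrary: y)
  case (Suc n)
  then show ?case
    using deriv_in_Reals[OF holomorphic_higher_deriv[OF assms(1)] assms(2)] by simp
qed (use assms(3) in simp)

lemma Reals_on_closure:
  assumes "continuous_on {-1..1} (\<lambda>x. h x :: complex)" "\<And>y. y \<in> {-1<..<1::real} \<Longrightarrow> h y \<in> \<real>"
    and "y \<in> {-1..1}"
  shows "h y \<in> \<real>"
proof -
  have "h ` closure {-1<..<1} \<subseteq> \<real>"
    by (rule image_closure_subset) (use assms closed_complex_Reals in auto)
  then show ?thesis using assms(3) by auto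
qed

text \<open>On the circle |z| = s the conjugate of z is s^2/z, so the circle average against the
  k-th basis function is a Cauchy integral for the k-th Taylor coefficient, times s^(2k)/\<rho>^k.
  The limit s \<rightarrow> \<rho> leaves \<rho>^k.\<close>

lemma hardy_inner_hardy_basis:
  assumes F: "F holomorphic_on ball 0 R" and \<rho>: "0 < \<rho>" "\<rho> < R"
  shows "hardy_inner \<rho> F (hardy_basis \<rho> k) = of_real \<rho> ^ k * ((deriv ^^ k) F 0 / fact k)"
proof -
  define c where "c = (deriv ^^ k) F 0 / fact k"
  have "integral {0..2 * pi} (\<lambda>t. F (of_real s * cis t) * cnj (hardy_basis \<rho> k (of_real s * cis t))) / (2 * pi)
      = of_real (s ^ (2 * k) / \<rho> ^ k) * c" if s: "0 < s" "s < \<rho>" for s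
  proof -
    have "((\<lambda>u. F u / (u - 0) ^ Suc k) has_contour_integral (2 * pi * \<i>) / fact k * (deriv ^^ k) F 0) (circlepath 0 s)"
      by (rule Cauchy_has_contour_integral_higher_derivative_circlepath)
        (use s \<rho> in \<open>auto intro!: holomorphic_on_imp_continuous_on holomorphic_on_subset[OF F]\<close>)
    then have "((\<lambda>t. F (of_real s * cis t) / (of_real s * cis t) ^ Suc k * of_real s * \<i> * cis t)
        has_integral (2 * pi * \<i>) / fact k * (deriv ^^ k) F 0) {0..2 * pi}"
      unfolding circlepath_def by (subst (asm) has_contour_integral_part_circlepath_iff) auto
    then have "((\<lambda>t. of_real (s ^ (2 * k) / \<rho> ^ k) / \<i> *
          (F (of_real s * cis t) / (of_real s * cis t) ^ Suc k * of_real s * \<i> * cis t))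
        has_integral of_real (s ^ (2 * k) / \<rho> ^ k) / \<i> * ((2 * pi * \<i>) / fact k * (deriv ^^ k) F 0)) {0..2 * pi}"
      by (rule has_integral_mult_right)
    moreover have "of_real (s ^ (2 * k) / \<rho> ^ k) / \<i> *
          (F (of_real s * cis t) / (of_real s * cis t) ^ Suc k * of_real s * \<i> * cis t)
        = F (of_real s * cis t) * cnj (hardy_basis \<rho> k (of_real s * cis t))" for t
    proof -
      have "cnj (of_real s * cis t / of_real \<rho>) * (of_real s * cis t) = of_real (s\<^sup>2 / \<rho>)"
        by (simp add: cis_cnj cis_mult power2_eq_square)
      then have "(cnj (of_real s * cis t / of_real \<rho>) * (of_real s * cis t)) ^ k = of_real (s ^ (2 * k) / \<rho> ^ k)"
        by (simp only:) (simp add: power_mult power_divide)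
      then have "cnj (hardy_basis \<rho> k (of_real s * cis t)) * (of_real s * cis t) ^ k = of_real (s ^ (2 * k) / \<rho> ^ k)"
        by (simp only: hardy_basis_def complex_cnj_power power_mult_distrib)
      moreover have "p / \<i> * (z * x * \<i> * y) = p * z * (x * y)" for p z x y
        by (simp add: field_simps)
      moreover have "of_real s * cis t \<noteq> 0" using s by simp
      ultimately have "of_real (s ^ (2 * k) / \<rho> ^ k) / \<i> *
          (F (of_real s * cis t) / (of_real s * cis t) ^ Suc k * of_real s * \<i> * cis t)
        = cnj (hardy_basis \<rho> k (of_real s * cis t)) * (of_real s * cis t) ^ k
          * (F (of_real s * cis t) / (of_real s * cis t) ^ Suc k) * (of_real s * cis t)"
        by (simp only:)
      \<comment> \<open>X hides the product s cis t, so that the simplifier cancels its powers as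
        those of a single nonzero factor.\<close>
      also have "\<dots> = F X * cnj (hardy_basis \<rho> k X)" if "X = of_real s * cis t" for X
        using \<open>of_real s * cis t \<noteq> 0\<close> unfolding that[symmetric] by simp
      finally show ?thesis by simp
    qed
    ultimately have "integral {0..2 * pi} (\<lambda>t. F (of_real s * cis t) * cnj (hardy_basis \<rho> k (of_real s * cis t)))
       = of_real (s ^ (2 * k) / \<rho> ^ k) / \<i> * ((2 * pi * \<i>) / fact k * (deriv ^^ k) F 0)"
      by (simp add: integral_unique)
    then show ?thesis by (simp add: c_def field_simps)
  qed
  then have "eventually (\<lambda>s. of_real (s ^ (2 * k) / \<rho> ^ k) * c =
      integral {0..2 * pi} (\<lambda>t. F (of_real s * cis t) * cnj (hardy_basis \<rho> k (of_real s * cis t))) / (2 * pi)) (at_left \<rho>)"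
    using \<rho> by (auto simp: eventually_at_left intro!: exI[of _ 0])
  moreover have "((\<lambda>s. of_real (s ^ (2 * k) / \<rho> ^ k) * c) \<longlongrightarrow> of_real (\<rho> ^ (2 * k) / \<rho> ^ k) * c) (at_left \<rho>)"
    using \<rho> by (intro tendsto_intros) auto
  ultimately have "((\<lambda>s. integral {0..2 * pi} (\<lambda>t. F (of_real s * cis t) * cnj (hardy_basis \<rho> k (of_real s * cis t))) / (2 * pi))
      \<longlongrightarrow> of_real (\<rho> ^ (2 * k) / \<rho> ^ k) * c) (at_left \<rho>)"
    by (rule Lim_transform_eventually[rotated])
  then have "hardy_inner \<rho> F (hardy_basis \<rho> k) = of_real (\<rho> ^ (2 * k) / \<rho> ^ k) * c"
    unfolding hardy_inner_def by (intro tendsto_Lim) auto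
  also have "\<rho> ^ (2 * k) / \<rho> ^ k = \<rho> ^ k" using \<rho> by (simp add: mult_2 power_add)
  finally show ?thesis by (simp add: c_def)
qed

section \<open>Real structure of the inverse branches\<close>

locale analytic_branches =
  fixes T :: "real \<Rightarrow> real" and d :: nat and a b :: "nat \<Rightarrow> real"
    and phi :: "nat \<Rightarrow> complex \<Rightarrow> complex" and r R :: real
  assumes full_branch: "full_branch_map T d a b phi r R"
begin

text \<open>Real parts give the real-variable data that \<open>real_branches\<close> asks for; on
  [-1,1] nothing is lost, by \<open>phi_Reals\<close> and \<open>deriv_phi_Reals\<close>.\<close>

definition \<psi> :: "nat \<Rightarrow> real \<Rightarrow> real" where "\<psi> i y = Re (phi i (of_real y))"
definition \<psi>' :: "nat \<Rightarrow> real \<Rightarrow> real" where "\<psi>' i y = Re (deriv (phi i) (of_real y))"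
definition \<sigma> :: "nat \<Rightarrow> real" where "\<sigma> i = sgn (Re (deriv (phi i) 0))"

lemma r_R: "1 < r" "r < R"
  using full_branch by (auto simp: full_branch_map_def)

lemma phi_holomorphic: "i < d \<Longrightarrow> phi i holomorphic_on ball 0 R"
  using full_branch by (auto simp: full_branch_map_def)

lemma phi_bound: "i < d \<Longrightarrow> z \<in> ball 0 R \<Longrightarrow> norm (phi i z) < r"
proof -
  assume "i < d" "z \<in> ball 0 R"
  moreover from this have "phi i ` ball 0 R \<subseteq> ball 0 r"
    using full_branch by (simp add: full_branch_map_def)
  ultimately have "phi i z \<in> ball 0 r" by blast
  then show ?thesis by simp
qed

lemma branch_bij: "i < d \<Longrightarrow> bij_betw T {a i<..<b i} {-1<..<1}"
  using full_branch by (auto simp: full_branch_map_def)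

lemma phi_real_open:
  assumes "i < d" "y \<in> {-1<..<1}"
  shows "phi i (of_real y) = of_real (the_inv_into {a i<..<b i} T y)"
  using full_branch assms unfolding full_branch_map_def by blast

text \<open>The inverse branch is prescribed only over the open interval. As R > 1,
  \<open>phi i\<close> is continuous up to the endpoints, and the set of reals is closed.\<close>

lemma phi_Reals:
  assumes "i < d" "y \<in> {-1..1}"
  shows "phi i (of_real y) \<in> \<real>"
proof (rule Reals_on_closure[of "\<lambda>y. phi i (of_real y)"])
  show "continuous_on {-1..1} (\<lambda>y. phi i (of_real y))"
    by (rule continuous_on_compose2[OF holomorphic_on_imp_continuous_on[OF phi_holomorphic]])
      (use assms r_R in \<open>auto intro!: continuous_intros\<close>)
qed (use assms phi_real_open in auto)

lemma continuous_on_deriv_phi: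
  assumes "i < d"
  shows "continuous_on {-1..1} (\<lambda>y. deriv (phi i) (of_real y))"
  by (rule continuous_on_compose2[OF holomorphic_on_imp_continuous_on[OF holomorphic_deriv[OF phi_holomorphic]]])
    (use assms r_R in \<open>auto intro!: continuous_intros\<close>)

lemma deriv_phi_Reals:
  assumes "i < d" "y \<in> {-1..1}"
  shows "deriv (phi i) (of_real y) \<in> \<real>"
proof (rule Reals_on_closure[of "\<lambda>y. deriv (phi i) (of_real y)"])
  show "continuous_on {-1..1} (\<lambda>y. deriv (phi i) (of_real y))"
    by (rule continuous_on_deriv_phi[OF assms(1)])
  show "deriv (phi i) (of_real y) \<in> \<real>" if "y \<in> {-1<..<1}" for y
    by (rule deriv_in_Reals[OF phi_holomorphic[OF assms(1)]]) (use r_R that phi_Reals assms in auto)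
qed (use assms in auto)

lemma \<psi>_derivative:
  assumes "i < d" "y \<in> {-1..1}"
  shows "(\<psi> i has_real_derivative \<psi>' i y) (at y within A)"
proof -
  have "(phi i has_field_derivative deriv (phi i) (of_real y)) (at (of_real y))"
    using assms r_R by (intro holomorphic_derivI[OF phi_holomorphic]) auto
  then show ?thesis
    unfolding \<psi>_def[abs_def] \<psi>'_def by (rule has_real_derivative_Re_Im_of_real)
qed

lemma \<psi>_inverse:
  assumes "i < d"
  shows "y \<in> {-1<..<1} \<Longrightarrow> \<psi> i y \<in> {a i<..<b i} \<and> T (\<psi> i y) = y"
    and "x \<in> {a i<..<b i} \<Longrightarrow> T x \<in> {-1<..<1} \<and> \<psi> i (T x) = x"
proof -
  have bij: "inj_on T {a i<..<b i}" "T ` {a i<..<b i} = {-1<..<1}"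
    using branch_bij[OF assms] by (auto simp: bij_betw_def)
  have \<psi>: "\<psi> i y = the_inv_into {a i<..<b i} T y" if "y \<in> {-1<..<1}" for y
    using phi_real_open[OF assms that] by (simp add: \<psi>_def)
  show "\<psi> i y \<in> {a i<..<b i} \<and> T (\<psi> i y) = y" if "y \<in> {-1<..<1}"
    using \<psi>[OF that] the_inv_into_into[OF bij(1) _ subset_refl, of y] f_the_inv_into_f[OF bij(1), of y] bij(2) that
    by auto
  show "T x \<in> {-1<..<1} \<and> \<psi> i (T x) = x" if "x \<in> {a i<..<b i}"
  proof -
    have "T x \<in> {-1<..<1}" using bij(2) that by blast
    then show ?thesis using \<psi>[of "T x"] the_inv_into_f_f[OF bij(1) that] by simp
  qed
qed

text \<open>T is differentiable inside the branch, so the chain rule applied to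
  \<open>T (\<psi> i y) = y\<close> makes the derivative a factor of 1.\<close>

lemma \<psi>'_nonzero:
  assumes "i < d" "y \<in> {-1<..<1}"
  shows "\<psi>' i y \<noteq> 0"
proof -
  have "\<psi> i y \<in> {a i<..<b i}" using \<psi>_inverse(1)[OF assms] by blast
  moreover have "\<forall>x\<in>{a i<..<b i}. \<exists>D. D \<noteq> 0 \<and> (T has_real_derivative D) (at x)"
    using full_branch assms(1) by (simp add: full_branch_map_def)
  ultimately obtain D where D: "(T has_real_derivative D) (at (\<psi> i y))"
    by blast
  have "((\<lambda>y. T (\<psi> i y)) has_real_derivative D * \<psi>' i y) (at y)"
    by (rule DERIV_chain2[OF D \<psi>_derivative]) (use assms in auto)
  then have "((\<lambda>y. y) has_real_derivative D * \<psi>' i y) (at y)"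
    by (rule has_field_derivative_transform_within_open[where S = "{-1<..<1}"])
      (use \<psi>_inverse(1) assms in auto)
  then have "D * \<psi>' i y = 1" using DERIV_unique DERIV_ident by blast
  then show ?thesis by auto
qed

lemma continuous_on_\<psi>:
  assumes "i < d"
  shows "continuous_on {-1..1} (\<psi> i)"
  using \<psi>_derivative[OF assms] by (meson DERIV_continuous continuous_on_eq_continuous_within)

lemma continuous_on_\<psi>':
  assumes "i < d"
  shows "continuous_on {-1..1} (\<psi>' i)"
  unfolding \<psi>'_def[abs_def] by (intro continuous_intros continuous_on_deriv_phi assms)

text \<open>The sign at 0 persists: a continuous function without zeros on an interval cannot change
  sign.\<close>

lemma \<sigma>_\<psi>'_pos:
  assumes "i < d" "y \<in> {-1<..<1}"
  shows "\<sigma> i * \<psi>' i y > 0"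
proof -
  have "connected (\<psi>' i ` {-1<..<1})"
    by (intro connected_continuous_image continuous_on_subset[OF continuous_on_\<psi>'[OF assms(1)]]) auto
  then have Icc: "{p..q} \<subseteq> \<psi>' i ` {-1<..<1}" if "p \<in> \<psi>' i ` {-1<..<1}" "q \<in> \<psi>' i ` {-1<..<1}" for p q
    using that by (rule connected_contains_Icc)
  have zero: "0 \<notin> \<psi>' i ` {-1<..<1}" using \<psi>'_nonzero[OF assms(1)] by auto
  have p: "\<psi>' i 0 \<in> \<psi>' i ` {-1<..<1}" and q: "\<psi>' i y \<in> \<psi>' i ` {-1<..<1}" using assms by auto
  have "\<sigma> i = sgn (\<psi>' i 0)" by (simp add: \<sigma>_def \<psi>'_def)
  moreover have "\<psi>' i 0 \<noteq> 0" "\<psi>' i y \<noteq> 0" using zero p q by auto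
  ultimately show ?thesis using Icc[OF p q] Icc[OF q p] zero
    by (cases "\<psi>' i 0 > 0"; cases "\<psi>' i y > 0") (auto simp: subset_iff)
qed

lemma \<sigma>_cases: "i < d \<Longrightarrow> \<sigma> i = 1 \<or> \<sigma> i = -1"
  using \<psi>'_nonzero[of i 0] by (auto simp: \<sigma>_def \<psi>'_def sgn_real_def)

sublocale real_branches T d a b \<psi> \<psi>' \<sigma>
proof
  show "\<And>x. x \<in> {-1..1} \<Longrightarrow> T x \<in> {-1..1}" "(\<Union>i<d. {a i..b i}) = {-1..1}"
    "\<And>i. i < d \<Longrightarrow> -1 \<le> a i \<and> a i < b i \<and> b i \<le> 1"
    using full_branch by (simp_all add: full_branch_map_def)
  show "\<And>i j. i < d \<Longrightarrow> j < d \<Longrightarrow> i \<noteq> j \<Longrightarrow> {a i<..<b i} \<inter> {a j<..<b j} = {}"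
    using full_branch by (simp add: full_branch_map_def)
qed (use \<psi>_derivative continuous_on_\<psi>' \<sigma>_cases \<sigma>_\<psi>'_pos \<psi>_inverse in auto)

section \<open>Images of the monomials under the transfer operator\<close>

definition image_monom :: "nat \<Rightarrow> complex \<Rightarrow> complex" where
  "image_monom l = transfer_op d phi (\<lambda>z. z ^ l)"

definition image_coeff :: "nat \<Rightarrow> nat \<Rightarrow> real" where
  "image_coeff l k = Re ((deriv ^^ k) (image_monom l) 0 / fact k)"

lemma image_monom_eq: "image_monom l z = (\<Sum>i<d. of_real (\<sigma> i) * deriv (phi i) z * phi i z ^ l)"
  by (simp add: image_monom_def transfer_op_def branch_sign_def \<sigma>_def)

lemma image_monom_holomorphic: "image_monom l holomorphic_on ball 0 R"
  unfolding image_monom_eq[abs_def]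
  by (intro holomorphic_intros holomorphic_deriv phi_holomorphic) auto

text \<open>The link between the operator and the data: multiplied by y^k, this sum over branches is
  the sum of the integrands in \<open>quadrature\<close>.\<close>

lemma image_monom_real:
  assumes "y \<in> {-1..1}"
  shows "image_monom l (of_real y) = of_real (\<Sum>i<d. \<sigma> i * \<psi>' i y * \<psi> i y ^ l)"
proof -
  have "phi i (of_real y) = of_real (\<psi> i y)" "deriv (phi i) (of_real y) = of_real (\<psi>' i y)" if "i < d" for i
    using phi_Reals[OF that assms] deriv_phi_Reals[OF that assms] by (simp_all add: \<psi>_def \<psi>'_def)
  then show ?thesis by (simp add: image_monom_eq)
qed

text \<open>The image of a monomial is real on the real segment, hence so are all its derivatives at
  0, and taking the real part in \<open>image_coeff\<close> changes nothing.\<close>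

lemma of_real_image_coeff: "of_real (image_coeff l k) = (deriv ^^ k) (image_monom l) 0 / fact k"
proof -
  have "(deriv ^^ k) (image_monom l) (of_real 0) \<in> \<real>"
    by (rule higher_deriv_in_Reals[OF image_monom_holomorphic]) (use r_R image_monom_real in auto)
  moreover have "fact k \<in> (\<real> :: complex set)" by (metis Reals_of_real of_real_fact)
  ultimately have "(deriv ^^ k) (image_monom l) 0 / fact k \<in> \<real>" by (simp add: Reals_divide)
  then show ?thesis unfolding image_coeff_def by simp
qed

lemma image_coeff_sums:
  assumes "y \<in> {-1..1}"
  shows "(\<lambda>k. image_coeff l k * y ^ k) sums (\<Sum>i<d. \<sigma> i * \<psi>' i y * \<psi> i y ^ l)"
proof -
  have "(\<lambda>k. (deriv ^^ k) (image_monom l) 0 / fact k * (of_real y - 0) ^ k) sums image_monom l (of_real y)"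
    by (rule holomorphic_power_series[OF image_monom_holomorphic]) (use r_R assms in auto)
  then have "(\<lambda>k. complex_of_real (image_coeff l k * y ^ k)) sums of_real (\<Sum>i<d. \<sigma> i * \<psi>' i y * \<psi> i y ^ l)"
    unfolding image_monom_real[OF assms] by (simp add: of_real_image_coeff)
  then show ?thesis by (simp only: sums_of_real_iff)
qed

text \<open>The diagonal weights come out exactly as in \<open>edmd_matrix\<close>, so on the block
  the comparison reduces to one of unweighted coefficients.\<close>

lemma transfer_matrix_eq:
  assumes "0 < \<rho>" "\<rho> < R"
  shows "transfer_matrix d phi \<rho> k l = of_real (\<rho> ^ k * image_coeff l k / \<rho> ^ l)"
proof -
  have "transfer_op d phi (hardy_basis \<rho> l) = (\<lambda>z. image_monom l z / of_real \<rho> ^ l)"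
    by (simp add: fun_eq_iff image_monom_def transfer_op_def hardy_basis_def power_divide sum_divide_distrib)
  moreover have "(deriv ^^ k) (\<lambda>z. image_monom l z / of_real \<rho> ^ l) 0 = (deriv ^^ k) (image_monom l) 0 / of_real \<rho> ^ l"
    unfolding divide_inverse mult.commute[of _ "inverse _"]
    by (rule higher_deriv_cmult[OF image_monom_holomorphic]) (use assms in auto)
  ultimately have "transfer_matrix d phi \<rho> k l = of_real \<rho> ^ k * ((deriv ^^ k) (image_monom l) 0 / of_real \<rho> ^ l / fact k)"
    unfolding transfer_matrix_def
    using hardy_inner_hardy_basis[of "\<lambda>z. image_monom l z / of_real \<rho> ^ l" R \<rho> k] assms
    by (simp add: holomorphic_intros image_monom_holomorphic)
  then show ?thesis by (simp add: of_real_image_coeff mult.commute)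
qed

text \<open>The branches map into the disc of radius r, which gives r^l; the Cauchy estimate on the
  circle of radius R' gives the decay in k. K collects suprema of the derivatives of the branches,
  finite because the closed disc of radius R' < R is compact.\<close>

lemma image_coeff_bound:
  assumes R': "0 < R'" "R' < R"
  obtains K where "0 \<le> K" "\<And>k l. \<bar>image_coeff l k\<bar> \<le> K * r ^ l / R' ^ k"
proof -
  have "\<exists>K. \<forall>z\<in>cball 0 R'. norm (deriv (phi i) z) \<le> K" if "i < d" for i
  proof -
    have "continuous_on (cball 0 R') (deriv (phi i))"
      by (intro holomorphic_on_imp_continuous_on holomorphic_on_subset[OF holomorphic_deriv[OF phi_holomorphic[OF that]]])
        (use R' in auto)
    then have "bounded (deriv (phi i) ` cball 0 R')"
      by (intro compact_imp_bounded compact_continuous_image) auto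
    then show ?thesis by (auto simp: bounded_iff)
  qed
  then obtain K where K: "\<And>i z. i < d \<Longrightarrow> z \<in> cball 0 R' \<Longrightarrow> norm (deriv (phi i) z) \<le> K i" by metis
  have K0: "0 \<le> K i" if "i < d" for i 
    by (rule order_trans[OF norm_ge_zero K[OF that, of 0]]) (use R' in simp)
  have bnd: "norm (image_monom l z) \<le> (\<Sum>i<d. K i) * r ^ l" if "norm (0 - z) = R'" for z l
  proof -
    have "norm (image_monom l z) \<le> (\<Sum>i<d. norm (of_real (\<sigma> i) * deriv (phi i) z * phi i z ^ l))"
      unfolding image_monom_eq by (rule norm_sum)
    also have "\<dots> \<le> (\<Sum>i<d. K i * r ^ l)"
    proof (rule sum_mono)
      fix i assume "i \<in> {..<d}"
      then have i: "i < d" by simp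
      have "norm (deriv (phi i) z) \<le> K i" using that by (intro K i) auto
      moreover have "norm (phi i z ^ l) \<le> r ^ l"
        unfolding norm_power using phi_bound[OF i, of z] that R' by (intro power_mono) auto
      moreover have "norm (complex_of_real (\<sigma> i)) = 1" using \<sigma>_cases[OF i] by auto
      ultimately show "norm (of_real (\<sigma> i) * deriv (phi i) z * phi i z ^ l) \<le> K i * r ^ l"
        unfolding norm_mult using K0[OF i] by (simp add: mult_mono)
    qed
    finally show ?thesis by (simp add: sum_distrib_right)
  qed
  show ?thesis
  proof (rule that)
    show "0 \<le> (\<Sum>i<d. K i)" using K0 by (intro sum_nonneg) auto
    fix k l
    have "norm ((deriv ^^ k) (image_monom l) 0) \<le> fact k * ((\<Sum>i<d. K i) * r ^ l) / R' ^ k"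
      by (rule Cauchy_inequality)
        (use R' bnd in \<open>auto intro!: holomorphic_on_imp_continuous_on holomorphic_on_subset[OF image_monom_holomorphic]\<close>)
    then have "norm ((deriv ^^ k) (image_monom l) 0 / fact k) \<le> (\<Sum>i<d. K i) * r ^ l / R' ^ k"
      by (simp add: norm_divide field_simps)
    then show "\<bar>image_coeff l k\<bar> \<le> (\<Sum>i<d. K i) * r ^ l / R' ^ k"
      unfolding of_real_image_coeff[symmetric] by simp
  qed
qed

end

section \<open>Column-wise error estimate\<close>

text \<open>A unit vector has entries of modulus at most 1, so the triangle inequality bounds its
  image by the sum of the column norms. Finite sections of the columns suffice: uniform bounds on
  them yield square summability of the image.\<close>

lemma l2_opnorm_le_sum_columns:
  assumes col: "\<And>l n. L2_set (\<lambda>k. cmod (A k l)) {..<n} \<le> c l"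
    and sum: "\<And>n. (\<Sum>l<n. c l) \<le> B"
  shows "l2_opnorm A \<le> ennreal B"
  unfolding l2_opnorm_def
proof (rule SUP_least, clarify)
  fix n :: nat and x :: "nat \<Rightarrow> complex"
  assume x: "\<forall>j\<ge>n. x j = 0" "l2_norm_seq x \<le> 1"
  define y where "y = (\<lambda>k. \<Sum>j<n. A k j * x j)"
  have c0: "0 \<le> c l" for l using col[of l 0] by simp
  have B0: "0 \<le> B" using sum[of 0] by simp
  have summ: "summable (\<lambda>k. (cmod (x k))\<^sup>2)"
    by (rule summable_finite[of "{..<n}"]) (use x in auto)
  then have "(\<Sum>k. (cmod (x k))\<^sup>2) \<le> 1"
    using x(2) by (simp add: l2_norm_seq_def)
  moreover have "(cmod (x j))\<^sup>2 \<le> (\<Sum>k. (cmod (x k))\<^sup>2)" for j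
    using sum_le_suminf[OF summ, of "{j}"] by simp
  ultimately have "(cmod (x j))\<^sup>2 \<le> 1\<^sup>2" for j by (metis order_trans one_power2)
  then have x1: "cmod (x j) \<le> 1" for j by (rule power2_le_imp_le) simp
  have L2: "L2_set (\<lambda>k. cmod (\<Sum>j<m. A k j * x j)) {..<K} \<le> (\<Sum>j<m. c j)" for K m
  proof (induction m)
    case (Suc m)
    have "L2_set (\<lambda>k. cmod (\<Sum>j<Suc m. A k j * x j)) {..<K}
        \<le> L2_set (\<lambda>k. cmod (\<Sum>j<m. A k j * x j) + cmod (A k m)) {..<K}"
    proof (rule L2_set_mono)
      fix k
      have "cmod (A k m * x m) \<le> cmod (A k m) * 1"
        unfolding norm_mult by (intro mult_left_mono x1) auto
      then show "cmod (\<Sum>j<Suc m. A k j * x j) \<le> cmod (\<Sum>j<m. A k j * x j) + cmod (A k m)"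
        by (auto intro: order_trans[OF norm_triangle_ineq])
    qed auto
    also have "\<dots> \<le> L2_set (\<lambda>k. cmod (\<Sum>j<m. A k j * x j)) {..<K} + L2_set (\<lambda>k. cmod (A k m)) {..<K}"
      by (rule L2_set_triangle_ineq)
    also have "\<dots> \<le> (\<Sum>j<m. c j) + c m" by (intro add_mono Suc col)
    finally show ?case by simp
  qed (simp add: L2_set_def)
  have partial: "(\<Sum>k<K. (cmod (y k))\<^sup>2) \<le> B\<^sup>2" for K
  proof -
    have "L2_set (\<lambda>k. cmod (y k)) {..<K} \<le> B"
      unfolding y_def by (rule order_trans[OF L2 sum])
    then have "(L2_set (\<lambda>k. cmod (y k)) {..<K})\<^sup>2 \<le> B\<^sup>2" by (intro power_mono) auto
    then show ?thesis by (simp add: L2_set_def sum_nonneg)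
  qed
  have "summable (\<lambda>k. (cmod (y k))\<^sup>2)"
    by (rule summableI_nonneg_bounded[OF _ partial]) simp
  moreover from this have "sqrt (\<Sum>k. (cmod (y k))\<^sup>2) \<le> B"
    using partial B0 by (intro real_le_lsqrt suminf_le_const) auto
  ultimately show "l2_norm_seq (\<lambda>k. \<Sum>j<n. A k j * x j) \<le> ennreal B"
    by (simp add: l2_norm_seq_def y_def ennreal_leI)
qed

lemma sum_power_le:
  fixes x :: real
  assumes "0 \<le> x" "x < 1" "finite A"
  shows "(\<Sum>k\<in>A. x ^ k) \<le> 1 / (1 - x)"
  using sum_le_suminf[OF summable_geometric, of x A] assms suminf_geometric[of x] by simp

lemma power2_powr_half:
  fixes s :: real
  assumes "0 < s"
  shows "(s\<^sup>2) powr (real N / 2) = s ^ N"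
proof -
  have "(s\<^sup>2) powr (real N / 2) = (s powr 2) powr (real N / 2)" using assms by simp
  also have "\<dots> = s powr real N" unfolding powr_powr by simp
  finally show ?thesis using assms by (simp add: powr_realpow)
qed

section \<open>Errors of single columns and their sum\<close>

context analytic_branches
begin

lemma G_mat_moment:
  assumes "1 \<le> M" "0 \<le> \<delta>" "\<delta> \<le> 2 / real M" "k < N" "l < N"
  shows "\<bar>G_mat T N M \<delta> k l - integral {-1..1} (\<lambda>y. y ^ k * (\<Sum>i<d. \<sigma> i * \<psi>' i y * \<psi> i y ^ l)) / 2\<bar>
    \<le> 4 * real d * real N / real M"
proof -
  have "integral {-1..1} (\<lambda>y. y ^ k * (\<Sum>i<d. \<sigma> i * \<psi>' i y * \<psi> i y ^ l))
      = (\<Sum>i<d. integral {-1..1} (\<lambda>y. \<sigma> i * \<psi>' i y * (y ^ k * \<psi> i y ^ l)))"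
    unfolding sum_distrib_left
    by (subst integral_sum)
      (auto intro!: integrable_continuous_interval continuous_intros continuous_on_\<psi> continuous_on_\<psi>' sum.cong simp: mult_ac)
  then have "\<bar>G_mat T N M \<delta> k l - integral {-1..1} (\<lambda>y. y ^ k * (\<Sum>i<d. \<sigma> i * \<psi>' i y * \<psi> i y ^ l)) / 2\<bar>
    \<le> real d / real M * (3 + 2 * real k + 2 * real l)"
    using quadrature[OF assms(1-3), of k l] assms(4,5) by (simp add: G_mat_def)
  also have "\<dots> \<le> real d / real M * (4 * real N)"
  proof (intro mult_left_mono)
    have "real (Suc k) \<le> real N" "real (Suc l) \<le> real N" using assms by (simp_all del: of_nat_Suc)
    then show "3 + 2 * real k + 2 * real l \<le> 4 * real N" by simp
  qed simp
  finally show ?thesis by simp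
qed

text \<open>A is the geometric series in 1/R', convergent as R' > 1; it bounds both the sum of the
  coefficients and the Taylor tail on [-1,1]. The dependence on l is only through r^l, which decays
  once divided by \<rho>^l. The 20 is the 5 of \<open>least_squares_stability\<close> times the 4 of
  the entrywise errors.\<close>

lemma edmd_column_error:
  assumes R': "1 < R'"
    and K: "0 \<le> K" "\<And>k l. \<bar>image_coeff l k\<bar> \<le> K * r ^ l / R' ^ k"
    and M: "1 \<le> M" "0 \<le> \<delta>" "\<delta> \<le> 2 / real M"
    and large: "16 * (real N)\<^sup>2 * (1 + sqrt 2) ^ (2 * N) \<le> real M"
    and l: "l < N"
    and A: "A = 1 / (1 - 1 / R')"
  shows "L2_set (\<lambda>k. (\<Sum>j<N. block_inverse N (H_mat N M \<delta>) k j * G_mat T N M \<delta> j l) - image_coeff l k) {..<N}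
    \<le> (20 * (real d + K * A) + 3 * (K * A)) * r ^ l *
        ((1 + sqrt 2) ^ (2 * N) * (real N)\<^sup>2 / real M + ((1 + sqrt 2) / R') ^ N)"
proof -
  define g where "g = 1 + sqrt 2"
  define H where "H = H_mat N M \<delta>"
  define c where "c = image_coeff l"
  define f where "f = (\<lambda>y. \<Sum>i<d. \<sigma> i * \<psi>' i y * \<psi> i y ^ l)"
  define v where "v = (\<lambda>k. \<Sum>j<N. block_inverse N H k j * G_mat T N M \<delta> j l)"
  define q where "q = (\<lambda>y. f y - (\<Sum>j<N. c j * y ^ j))"
  \<comment> \<open>w is what remains when H is applied to the truncated Taylor coefficients: the
    quadrature error of G, and that of H acting on c.\<close>
  define w where "w = (\<lambda>k. (G_mat T N M \<delta> k l - integral {-1..1} (\<lambda>y. y ^ k * f y) / 2)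
                          + (\<Sum>j<N. (moment k j - H k j) * c j))"
  have contf: "continuous_on {-1..1} f"
    unfolding f_def by (intro continuous_intros continuous_on_\<psi>' continuous_on_\<psi>) auto
  have contq: "continuous_on {-1..1} q"
    unfolding q_def by (intro continuous_intros contf)
  have \<theta>: "0 \<le> 1 / R'" "1 / R' < 1" using R' by auto
  have A0: "0 \<le> A" using A R' by simp
  have rl: "1 \<le> r ^ l" using r_R by simp
  have g0: "0 < g" unfolding g_def by (simp add: add_pos_pos)
  have c_le: "\<bar>c k\<bar> \<le> K * r ^ l * (1 / R') ^ k" for k
    using K(2)[of l k] by (simp add: c_def power_divide)
  have eq: "(\<Sum>j<N. H k j * (v j - c j)) = w k + integral {-1..1} (\<lambda>y. y ^ k * q y) / 2" if k: "k < N" for k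
  proof -
    have "(\<Sum>j<N. H k j * v j) = (\<Sum>i<N. (\<Sum>j<N. H k j * block_inverse N H j i) * G_mat T N M \<delta> i l)"
      unfolding v_def sum_distrib_left sum_distrib_right by (subst sum.swap) (simp add: mult.assoc)
    also have "\<dots> = (\<Sum>i<N. if i = k then G_mat T N M \<delta> i l else 0)"
      unfolding H_def using k H_mat_block_inverse[OF M large] by (intro sum.cong) auto
    also have "\<dots> = G_mat T N M \<delta> k l" using k by simp
    finally have Hv: "(\<Sum>j<N. H k j * v j) = G_mat T N M \<delta> k l" .
    have "((\<lambda>y. y ^ k * f y - (\<Sum>j<N. c j * (y ^ k * y ^ j))) has_integral
        integral {-1..1} (\<lambda>y. y ^ k * f y) - (\<Sum>j<N. c j * integral {-1..1} (\<lambda>y. y ^ k * y ^ j))) {-1..1}"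
      by (intro has_integral_diff has_integral_sum has_integral_mult_right integrable_integral
          integrable_continuous_interval continuous_intros contf) auto
    moreover have "y ^ k * f y - (\<Sum>j<N. c j * (y ^ k * y ^ j)) = y ^ k * q y" for y
      by (simp add: q_def right_diff_distrib sum_distrib_left mult_ac)
    ultimately have "integral {-1..1} (\<lambda>y. y ^ k * q y) / 2
        = integral {-1..1} (\<lambda>y. y ^ k * f y) / 2 - (\<Sum>j<N. moment k j * c j)"
      by (simp add: integral_unique moment_def diff_divide_distrib sum_divide_distrib mult.commute)
    then show ?thesis
      using Hv by (simp add: w_def right_diff_distrib left_diff_distrib sum_subtractf diff_divide_distrib)
  qed
  \<comment> \<open>The decay of c lets the sum over j cost A instead of N, so that a single factor
    N remains.\<close>
  have w_le: "\<bar>w k\<bar> \<le> 4 * real N / real M * ((real d + K * A) * r ^ l)" if k: "k < N" for k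
  proof -
    have "\<bar>\<Sum>j<N. (moment k j - H k j) * c j\<bar> \<le> (\<Sum>j<N. 4 * real N / real M * (K * r ^ l * (1 / R') ^ j))"
    proof (rule order_trans[OF sum_abs sum_mono])
      fix j assume "j \<in> {..<N}"
      then have "\<bar>moment k j - H k j\<bar> \<le> 4 * real N / real M"
        using H_mat_moment[OF M k, of j] by (simp add: H_def abs_minus_commute)
      then show "\<bar>(moment k j - H k j) * c j\<bar> \<le> 4 * real N / real M * (K * r ^ l * (1 / R') ^ j)"
        unfolding abs_mult by (intro mult_mono c_le) auto
    qed
    also have "\<dots> = 4 * real N / real M * (K * r ^ l * (\<Sum>j<N. (1 / R') ^ j))"
      by (simp only: sum_distrib_left)
    also have "\<dots> \<le> 4 * real N / real M * (K * r ^ l * A)"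
      unfolding A using K(1) rl by (intro mult_left_mono sum_power_le \<theta>) auto
    finally have "\<bar>\<Sum>j<N. (moment k j - H k j) * c j\<bar> \<le> 4 * real N / real M * (K * r ^ l * A)" .
    moreover have "\<bar>G_mat T N M \<delta> k l - integral {-1..1} (\<lambda>y. y ^ k * f y) / 2\<bar> \<le> 4 * real N / real M * (real d * 1)"
      using G_mat_moment[OF M k l] unfolding f_def by (simp add: mult_ac)
    moreover have "4 * real N / real M * (real d * 1) \<le> 4 * real N / real M * (real d * r ^ l)"
      using rl by (intro mult_left_mono) auto
    ultimately have "\<bar>w k\<bar> \<le> 4 * real N / real M * (real d * r ^ l) + 4 * real N / real M * (K * r ^ l * A)"
      unfolding w_def by linarith
    also have "\<dots> = 4 * real N / real M * ((real d + K * A) * r ^ l)"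
    proof -
      have "t * (x * z) + t * (y * z * s) = t * ((x + y * s) * z)" for t x y z s :: real
        by (simp add: algebra_simps)
      then show ?thesis .
    qed
    finally show ?thesis .
  qed
  have q_le: "\<bar>q y\<bar> \<le> K * r ^ l * (1 / R') ^ N * A" if y: "y \<in> {-1..1}" for y
  proof -
    have "(\<lambda>j. c (j + N) * y ^ (j + N)) sums q y"
      using image_coeff_sums[OF y, of l] unfolding q_def c_def f_def
      by (subst sums_iff_shift) simp
    then have "q y = (\<Sum>j. c (j + N) * y ^ (j + N))" by (simp add: sums_unique)
    also have "norm \<dots> \<le> (\<Sum>j. K * r ^ l * (1 / R') ^ N * (1 / R') ^ j)"
    proof (rule norm_suminf_le)
      fix j
      have "\<bar>y ^ (j + N)\<bar> \<le> 1" using y by (auto simp: power_abs intro!: power_le_one)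
      then have "\<bar>c (j + N)\<bar> * \<bar>y ^ (j + N)\<bar> \<le> (K * r ^ l * (1 / R') ^ (j + N)) * 1"
        by (intro mult_mono c_le) (use K(1) rl \<theta> in auto)
      then show "norm (c (j + N) * y ^ (j + N)) \<le> K * r ^ l * (1 / R') ^ N * (1 / R') ^ j"
        by (simp add: abs_mult power_add mult_ac)
    qed (use \<theta> in \<open>auto intro!: summable_mult summable_geometric\<close>)
    also have "\<dots> = K * r ^ l * (1 / R') ^ N * A"
      unfolding A using \<theta> by (subst suminf_mult) (auto intro!: summable_geometric simp: suminf_geometric)
    finally show ?thesis by simp
  qed
  have "L2_set (\<lambda>k. v k - c k) {..<N}
      \<le> 5 * g ^ (2 * N) * L2_set w {..<N} + 3 * g ^ N * (K * r ^ l * (1 / R') ^ N * A)"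
    unfolding g_def using least_squares_stability[OF M large _ contq q_le, of "\<lambda>k. v k - c k" w] eq
    unfolding H_def by blast
  \<comment> \<open>The crude l^1 bound adds a second factor N, which gives the N^2 of the
    claim.\<close>
  also have "L2_set w {..<N} \<le> real N * (4 * real N / real M * ((real d + K * A) * r ^ l))"
  proof -
    have "L2_set w {..<N} \<le> (\<Sum>k<N. \<bar>w k\<bar>)" by (rule L2_set_le_sum_abs)
    also have "\<dots> \<le> (\<Sum>k<N. 4 * real N / real M * ((real d + K * A) * r ^ l))"
      using w_le by (intro sum_mono) auto
    finally show ?thesis by simp
  qed
  then have "5 * g ^ (2 * N) * L2_set w {..<N} + 3 * g ^ N * (K * r ^ l * (1 / R') ^ N * A)
      \<le> 5 * g ^ (2 * N) * (real N * (4 * real N / real M * ((real d + K * A) * r ^ l)))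
        + 3 * g ^ N * (K * r ^ l * (1 / R') ^ N * A)"
    using g0 by (intro add_right_mono mult_left_mono) auto
  also have "\<dots> = 20 * (real d + K * A) * r ^ l * (g ^ (2 * N) * (real N)\<^sup>2 / real M)
        + 3 * (K * A) * r ^ l * (g / R') ^ N"
    by (simp add: power_divide power2_eq_square algebra_simps)
  also have "\<dots> \<le> (20 * (real d + K * A) + 3 * (K * A)) * r ^ l * (g ^ (2 * N) * (real N)\<^sup>2 / real M)
        + (20 * (real d + K * A) + 3 * (K * A)) * r ^ l * (g / R') ^ N"
    using K(1) A0 rl g0 R' by (intro add_mono mult_right_mono) auto
  also have "\<dots> = (20 * (real d + K * A) + 3 * (K * A)) * r ^ l * (g ^ (2 * N) * (real N)\<^sup>2 / real M + (g / R') ^ N)"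
    by (simp only: distrib_left)
  finally show ?thesis by (simp add: v_def c_def H_def g_def)
qed

text \<open>All columns are measured against one quantity \<Omega>, which contains q^N with q =
  r/\<rho>. Inside the block it absorbs the scaled least squares error, outside it the discarded
  entries of the transfer matrix.\<close>

lemma edmd_error:
  assumes \<rho>: "\<rho> = sqrt (r * R / (1 + sqrt 2)\<^sup>2)" and rR: "r / R < 1 / (1 + sqrt 2)\<^sup>2"
  obtains C where "0 < C"
    "\<And>N M \<delta>. \<lbrakk>1 \<le> M; 0 \<le> \<delta>; \<delta> \<le> 2 / real M; 16 * (real N)\<^sup>2 * (1 + sqrt 2) ^ (2 * N) \<le> real M\<rbrakk> \<Longrightarrow>
       l2_opnorm (\<lambda>k l. edmd_matrix T \<rho> N M \<delta> k l - transfer_matrix d phi \<rho> k l)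
         \<le> ennreal (C * (((1 + sqrt 2)\<^sup>2 * \<rho>) ^ N * (real N)\<^sup>2 / real M + (r / \<rho>) ^ N))"
proof -
  define g where "g = 1 + sqrt 2"
  have g2: "2 \<le> g" by (simp add: g_def)
  have g4: "4 \<le> g\<^sup>2" using power_mono[OF g2, of 2] by simp
  have r: "0 < r" "1 < r" "0 < R" "r < R" using r_R by auto
  have \<rho>sq: "\<rho>\<^sup>2 = r * R / g\<^sup>2" using r unfolding \<rho> g_def by simp
  have \<rho>0: "0 \<le> \<rho>" using r unfolding \<rho> by simp
  \<comment> \<open>This is the hypothesis on r/R: r^2 < r R/\<gamma> holds exactly when r/R <
    1/\<gamma>.\<close>
  have "r\<^sup>2 < \<rho>\<^sup>2"
    using rR r g4 unfolding \<rho>sq g_def[symmetric] by (simp add: field_simps power2_eq_square)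
  then have r\<rho>: "r < \<rho>" using \<rho>0 by (rule power2_less_imp_less)
  have "\<rho>\<^sup>2 < R\<^sup>2"
  proof -
    have "r * R < R * R" using r by simp
    moreover have "r * R / g\<^sup>2 \<le> r * R / 1" using g4 r by (intro divide_left_mono) auto
    ultimately show ?thesis unfolding \<rho>sq by (simp add: power2_eq_square)
  qed
  then have \<rho>R: "\<rho> < R" using r by (intro power2_less_imp_less[of \<rho> R]) auto
  \<comment> \<open>The midpoint lies above R/2, and 2 \<le> 1 + sqrt 2 then gives the lower bound
    on R' that the tail needs.\<close>
  define R' where "R' = (\<rho> + R) / 2"
  have R': "\<rho> < R'" "R' < R" "1 < R'" "R \<le> g * R'" "0 < R'"
  proof -
    show "\<rho> < R'" "R' < R" "1 < R'" "0 < R'" using \<rho>R r\<rho> r by (auto simp: R'_def)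
    have "R \<le> 2 * R'" using \<rho>0 by (simp add: R'_def)
    also have "\<dots> \<le> g * R'" using g2 \<open>0 < R'\<close> by (intro mult_right_mono) auto
    finally show "R \<le> g * R'" .
  qed
  define q where "q = r / \<rho>"
  have q: "0 < q" "q < 1" using r r\<rho> by (auto simp: q_def)
  \<comment> \<open>The choice of \<rho> amounts to r/\<rho> = g^2 \<rho>/R, so that comparing the
    rate of the amplified tail with q reduces to R \<le> g R'.\<close>
  have gq: "g * \<rho> / R' \<le> q"
  proof -
    have "\<rho>\<^sup>2 * g\<^sup>2 = r * R" using \<rho>sq g2 by simp
    then have qR: "q = g\<^sup>2 * \<rho> / R"
      using r r\<rho> unfolding q_def by (simp add: field_simps power2_eq_square)
    have "g * \<rho> * R \<le> g * \<rho> * (g * R')"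
      using R' g2 \<rho>0 by (intro mult_left_mono) auto
    then show ?thesis using R' r unfolding qR by (simp add: field_simps power2_eq_square)
  qed
  have \<rho>q: "\<rho> / R' \<le> q"
  proof -
    have "1 * \<rho> / R' \<le> g * \<rho> / R'" using g2 \<rho>0 R' by (intro divide_right_mono mult_right_mono) auto
    then show ?thesis using gq by simp
  qed
  have \<rho>R'1: "0 \<le> \<rho> / R'" "\<rho> / R' < 1" using \<rho>0 R' by auto
  obtain K where K: "0 \<le> K" "\<And>k l. \<bar>image_coeff l k\<bar> \<le> K * r ^ l / R' ^ k"
    using image_coeff_bound[of R'] R' by blast
  define A where "A = 1 / (1 - 1 / R')"
  define A2 where "A2 = 1 / (1 - \<rho> / R')"
  define C1 where "C1 = 20 * (real d + K * A) + 3 * (K * A)"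
  have A0: "0 \<le> A" "0 \<le> A2" using R' by (auto simp: A_def A2_def)
  have C1: "0 \<le> C1" unfolding C1_def using K(1) A0 by simp
  \<comment> \<open>2/(1 - q) sums two geometric series, one for the columns below N and one for the
    others; the added 1 makes positivity immediate.\<close>
  define C where "C = (C1 + K * A2 + 1) * (2 / (1 - q))"
  have tail: "(\<Sum>k\<in>{m..<n}. \<rho> ^ k * \<bar>image_coeff l k\<bar> / \<rho> ^ l) \<le> K * A2 * q ^ l * q ^ m" for l m n
  proof -
    have "(\<Sum>k\<in>{m..<n}. \<rho> ^ k * \<bar>image_coeff l k\<bar> / \<rho> ^ l) \<le> (\<Sum>k\<in>{m..<n}. K * q ^ l * (\<rho> / R') ^ m * (\<rho> / R') ^ (k - m))"
    proof (rule sum_mono)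
      fix k assume k: "k \<in> {m..<n}"
      have "\<rho> ^ k * \<bar>image_coeff l k\<bar> / \<rho> ^ l \<le> \<rho> ^ k * (K * r ^ l / R' ^ k) / \<rho> ^ l"
        using \<rho>0 by (intro divide_right_mono mult_left_mono K(2)) auto
      also have "\<dots> = K * q ^ l * (\<rho> / R') ^ k"
        by (simp add: q_def power_divide mult_ac)
      also have "(\<rho> / R') ^ k = (\<rho> / R') ^ m * (\<rho> / R') ^ (k - m)"
        using k by (simp flip: power_add)
      finally show "\<rho> ^ k * \<bar>image_coeff l k\<bar> / \<rho> ^ l \<le> K * q ^ l * (\<rho> / R') ^ m * (\<rho> / R') ^ (k - m)"
        by (simp add: mult.assoc)
    qed
    also have "\<dots> = K * q ^ l * (\<rho> / R') ^ m * (\<Sum>k\<in>(\<lambda>k. k - m) ` {m..<n}. (\<rho> / R') ^ k)"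
      by (subst sum.reindex) (auto simp: inj_on_def sum_distrib_left)
    also have "\<dots> \<le> K * q ^ l * (\<rho> / R') ^ m * A2"
      unfolding A2_def using K(1) q \<rho>R'1 by (intro mult_left_mono sum_power_le) auto
    also have "\<dots> \<le> K * q ^ l * q ^ m * A2"
      using K(1) q \<rho>R'1 A0 \<rho>q by (intro mult_right_mono mult_left_mono power_mono) auto
    finally show ?thesis by (simp add: mult_ac)
  qed
  show ?thesis
  proof (rule that)
    show "0 < C" unfolding C_def using C1 K(1) A0 q
      by (intro mult_pos_pos add_nonneg_pos add_nonneg_nonneg) auto
    fix N M :: nat and \<delta> :: real
    assume M: "1 \<le> M" "0 \<le> \<delta>" "\<delta> \<le> 2 / real M" and large: "16 * (real N)\<^sup>2 * (1 + sqrt 2) ^ (2 * N) \<le> real M"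
    define D where "D = (\<lambda>k l. edmd_matrix T \<rho> N M \<delta> k l - transfer_matrix d phi \<rho> k l)"
    define \<Omega> where "\<Omega> = (g\<^sup>2 * \<rho>) ^ N * (real N)\<^sup>2 / real M + q ^ N"
    have \<Omega>: "q ^ N \<le> \<Omega>" unfolding \<Omega>_def using \<rho>0 by simp
    have \<Omega>0: "0 \<le> \<Omega>" using \<Omega> q by (meson order_trans zero_le_power less_imp_le)
    have transfer: "transfer_matrix d phi \<rho> k l = of_real (\<rho> ^ k * image_coeff l k / \<rho> ^ l)" for k l
      by (rule transfer_matrix_eq) (use r r\<rho> \<rho>R in auto)
    have D_outside: "cmod (D k l) = \<rho> ^ k * \<bar>image_coeff l k\<bar> / \<rho> ^ l" if "N \<le> k \<or> N \<le> l" for k l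
    proof -
      have "D k l = - of_real (\<rho> ^ k * image_coeff l k / \<rho> ^ l)"
        using that by (auto simp: D_def transfer edmd_matrix_def)
      then have "cmod (D k l) = \<bar>\<rho> ^ k * image_coeff l k / \<rho> ^ l\<bar>"
        by (simp only: norm_minus_cancel norm_of_real)
      then show ?thesis using \<rho>0 by (simp add: abs_mult)
    qed
    \<comment> \<open>For l \<ge> N the column is of order q^l, of which q^N is absorbed in \<Omega>
      and q^(l - N) is left for summation.\<close>
    have column: "L2_set (\<lambda>k. cmod (D k l)) {..<n}
        \<le> (C1 + K * A2 + 1) * \<Omega> * (if l < N then q ^ l else q ^ (l - N))" for l n
    proof (cases "l < N")
      case True
      define u where "u = (\<lambda>k. (\<Sum>j<N. block_inverse N (H_mat N M \<delta>) k j * G_mat T N M \<delta> j l) - image_coeff l k)"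
      define D1 where "D1 = (\<lambda>k. if k < N then \<rho> ^ N / \<rho> ^ l * \<bar>u k\<bar> else 0)"
      define D2 where "D2 = (\<lambda>k. if k < N then 0 else \<rho> ^ k * \<bar>image_coeff l k\<bar> / \<rho> ^ l)"
      have "cmod (D k l) \<le> D1 k + D2 k" for k
      proof (cases "k < N")
        case k: True
        have "D k l = of_real (\<rho> ^ k / \<rho> ^ l * u k)"
          using k True by (simp add: D_def edmd_matrix_def transfer u_def right_diff_distrib)
        then have "cmod (D k l) = \<bar>\<rho> ^ k / \<rho> ^ l * u k\<bar>" by (simp only: norm_of_real)
        also have "\<dots> = \<rho> ^ k / \<rho> ^ l * \<bar>u k\<bar>" using \<rho>0 by (simp add: abs_mult)
        \<comment> \<open>Here \<rho> > r > 1 makes the weights increase with k.\<close>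
        also have "\<dots> \<le> \<rho> ^ N / \<rho> ^ l * \<bar>u k\<bar>"
          using k r r\<rho> \<rho>0 by (intro mult_right_mono divide_right_mono power_increasing) auto
        finally show ?thesis using k by (simp add: D1_def D2_def)
      qed (simp add: D1_def D2_def D_outside)
      then have "L2_set (\<lambda>k. cmod (D k l)) {..<n} \<le> L2_set (\<lambda>k. D1 k + D2 k) {..<n}"
        by (intro L2_set_mono) auto
      also have "\<dots> \<le> L2_set D1 {..<n} + L2_set D2 {..<n}" by (rule L2_set_triangle_ineq)
      also have "L2_set D2 {..<n} \<le> K * A2 * \<Omega> * q ^ l"
      proof -
        have "L2_set D2 {..<n} \<le> sum D2 {..<n}"
          by (rule L2_set_le_sum) (use \<rho>0 in \<open>auto simp: D2_def\<close>)
        also have "sum D2 {..<n} = (\<Sum>k\<in>{N..<n}. \<rho> ^ k * \<bar>image_coeff l k\<bar> / \<rho> ^ l)"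
          by (rule sum.mono_neutral_cong_right) (auto simp: D2_def)
        also have "\<dots> \<le> K * A2 * q ^ l * q ^ N" by (rule tail)
        also have "\<dots> \<le> K * A2 * q ^ l * \<Omega>"
          using K(1) A0 q \<Omega> by (intro mult_left_mono) auto
        finally show ?thesis by (simp add: mult_ac)
      qed
      also have "L2_set D1 {..<n} \<le> C1 * \<Omega> * q ^ l"
      proof -
        have "(\<Sum>k<n. (D1 k)\<^sup>2) \<le> (\<Sum>k<N. (\<rho> ^ N / \<rho> ^ l * \<bar>u k\<bar>)\<^sup>2)"
        proof -
          have "(\<Sum>k<n. (D1 k)\<^sup>2) = (\<Sum>k\<in>{..<n} \<inter> {..<N}. (\<rho> ^ N / \<rho> ^ l * \<bar>u k\<bar>)\<^sup>2)"
            by (rule sum.mono_neutral_cong_right) (auto simp: D1_def)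
          also have "\<dots> \<le> (\<Sum>k<N. (\<rho> ^ N / \<rho> ^ l * \<bar>u k\<bar>)\<^sup>2)"
            by (rule sum_mono2) auto
          finally show ?thesis .
        qed
        then have "L2_set D1 {..<n} \<le> L2_set (\<lambda>k. \<rho> ^ N / \<rho> ^ l * \<bar>u k\<bar>) {..<N}"
          unfolding L2_set_def by (rule real_sqrt_le_mono)
        also have "\<dots> = \<rho> ^ N / \<rho> ^ l * L2_set u {..<N}"
          using \<rho>0 by (subst L2_set_right_distrib[symmetric]) (auto simp: L2_set_def)
        also have "\<dots> \<le> \<rho> ^ N / \<rho> ^ l * (C1 * r ^ l * (g ^ (2 * N) * (real N)\<^sup>2 / real M + (g / R') ^ N))"
          unfolding u_def C1_def g_def using \<rho>0
          by (intro mult_left_mono edmd_column_error[OF R'(3) K M large True A_def]) auto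
        also have "\<dots> = C1 * q ^ l * ((g\<^sup>2 * \<rho>) ^ N * (real N)\<^sup>2 / real M + (g * \<rho> / R') ^ N)"
          using power_mult[of g 2 N]
          by (simp add: q_def power_divide power_mult_distrib distrib_left mult_ac)
        also have "\<dots> \<le> C1 * q ^ l * \<Omega>"
          unfolding \<Omega>_def using gq C1 q \<rho>0 g2 R'
          by (intro mult_left_mono add_left_mono power_mono) auto
        finally show ?thesis by (simp add: mult_ac)
      qed
      finally have "L2_set (\<lambda>k. cmod (D k l)) {..<n} \<le> C1 * \<Omega> * q ^ l + K * A2 * \<Omega> * q ^ l" by simp
      moreover have "0 \<le> \<Omega> * q ^ l" using \<Omega>0 q by simp
      ultimately show ?thesis using True by (simp add: algebra_simps)
    next
      case False
      have "L2_set (\<lambda>k. cmod (D k l)) {..<n} \<le> (\<Sum>k<n. cmod (D k l))"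
        by (rule L2_set_le_sum) auto
      also have "\<dots> = (\<Sum>k\<in>{0..<n}. \<rho> ^ k * \<bar>image_coeff l k\<bar> / \<rho> ^ l)"
        using D_outside False by (simp add: atLeast0LessThan)
      also have "\<dots> \<le> K * A2 * q ^ l * q ^ 0" by (rule tail)
      also have "\<dots> = K * A2 * q ^ N * q ^ (l - N)"
        using False by (simp flip: power_add)
      also have "\<dots> \<le> (C1 + K * A2 + 1) * \<Omega> * q ^ (l - N)"
        using \<Omega> C1 K(1) A0 q \<Omega>0 by (intro mult_right_mono mult_mono) auto
      finally show ?thesis using False by simp
    qed
    have sum_le: "(\<Sum>l<n. if l < N then q ^ l else q ^ (l - N)) \<le> 2 / (1 - q)" for n
    proof -
      have "(\<Sum>l<n. if l < N then q ^ l else q ^ (l - N))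
         = (\<Sum>l\<in>{..<n} \<inter> {..<N}. q ^ l) + (\<Sum>l\<in>{N..<n}. q ^ (l - N))"
        by (subst sum.If_cases) (auto intro!: arg_cong2[of _ _ _ _ "(+)"] sum.cong)
      also have "(\<Sum>l\<in>{N..<n}. q ^ (l - N)) = (\<Sum>l\<in>(\<lambda>l. l - N) ` {N..<n}. q ^ l)"
        by (subst sum.reindex) (auto simp: inj_on_def)
      also have "(\<Sum>l\<in>{..<n} \<inter> {..<N}. q ^ l) + (\<Sum>l\<in>(\<lambda>l. l - N) ` {N..<n}. q ^ l) \<le> 1 / (1 - q) + 1 / (1 - q)"
        using q by (intro add_mono sum_power_le) auto
      finally show ?thesis by simp
    qed
    have "l2_opnorm D \<le> ennreal (C * \<Omega>)"
    proof (rule l2_opnorm_le_sum_columns[OF column])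
      fix n
      have "(\<Sum>l<n. (C1 + K * A2 + 1) * \<Omega> * (if l < N then q ^ l else q ^ (l - N)))
          = (C1 + K * A2 + 1) * \<Omega> * (\<Sum>l<n. if l < N then q ^ l else q ^ (l - N))"
        by (simp only: sum_distrib_left)
      also have "\<dots> \<le> (C1 + K * A2 + 1) * \<Omega> * (2 / (1 - q))"
        using C1 K(1) A0 \<Omega>0 by (intro mult_left_mono sum_le) auto
      finally show "(\<Sum>l<n. (C1 + K * A2 + 1) * \<Omega> * (if l < N then q ^ l else q ^ (l - N))) \<le> C * \<Omega>"
        by (simp add: C_def mult_ac)
    qed
    then show "l2_opnorm (\<lambda>k l. edmd_matrix T \<rho> N M \<delta> k l - transfer_matrix d phi \<rho> k l)
         \<le> ennreal (C * (((1 + sqrt 2)\<^sup>2 * \<rho>) ^ N * (real N)\<^sup>2 / real M + (r / \<rho>) ^ N))"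
      by (simp add: D_def \<Omega>_def g_def q_def)
  qed
qed

end

theorem theorem1:
  fixes T :: "real \<Rightarrow> real" and d :: nat and a b :: "nat \<Rightarrow> real"
    and phi :: "nat \<Rightarrow> complex \<Rightarrow> complex" and r R \<gamma> \<rho> :: real
  assumes "full_branch_map T d a b phi r R"
    and "\<gamma> = (1 + sqrt 2)\<^sup>2"
    and "r / R < 1 / \<gamma>"
    and "\<rho> = sqrt (r * R / \<gamma>)"
  shows "\<exists>C1>0. \<exists>C2>0. \<forall>N M :: nat. \<forall>\<delta> :: real.
           1 \<le> M \<longrightarrow> real M \<ge> C1 * real N ^ 2 * \<gamma> ^ N \<longrightarrow> 0 \<le> \<delta> \<longrightarrow> \<delta> \<le> 2 / real M \<longrightarrow>
           l2_opnorm (\<lambda>k l. edmd_matrix T \<rho> N M \<delta> k l - transfer_matrix d phi \<rho> k l)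
             \<le> ennreal (C2 * ((\<gamma> * r * R) powr (real N / 2) * real N ^ 2 / real M
                               + (\<gamma> * r / R) powr (real N / 2)))"
proof -
  interpret analytic_branches T d a b phi r R
    by unfold_locales (rule assms(1))
  have r: "0 < r" "0 < R" using r_R by auto
  have \<gamma>: "0 < \<gamma>" unfolding assms(2) by (intro zero_less_power) (simp add: add_pos_pos)
  have \<rho>: "0 < \<rho>" "\<rho>\<^sup>2 = r * R / \<gamma>" using r \<gamma> unfolding assms(4) by auto
  \<comment> \<open>By the choice of \<rho> both bases are squares, which turns the powers N/2 into
    natural powers of \<gamma> \<rho> and r/\<rho>.\<close>
  have "\<gamma> * r * R = (\<gamma> * \<rho>)\<^sup>2"
    using \<gamma> unfolding power_mult_distrib \<rho>(2) by (simp add: power2_eq_square)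
  then have powr1: "(\<gamma> * r * R) powr (real N / 2) = (\<gamma> * \<rho>) ^ N" for N
    using \<gamma> \<rho> by (simp add: power2_powr_half)
  have "\<gamma> * r / R = (r / \<rho>)\<^sup>2" using \<gamma> r unfolding power_divide \<rho>(2) by (simp add: power2_eq_square)
  then have powr2: "(\<gamma> * r / R) powr (real N / 2) = (r / \<rho>) ^ N" for N
    using r \<rho> by (simp add: power2_powr_half)
  obtain C where "0 < C" and C: "\<And>N M \<delta>. \<lbrakk>1 \<le> M; 0 \<le> \<delta>; \<delta> \<le> 2 / real M;
       16 * (real N)\<^sup>2 * (1 + sqrt 2) ^ (2 * N) \<le> real M\<rbrakk> \<Longrightarrow>
       l2_opnorm (\<lambda>k l. edmd_matrix T \<rho> N M \<delta> k l - transfer_matrix d phi \<rho> k l)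
         \<le> ennreal (C * (((1 + sqrt 2)\<^sup>2 * \<rho>) ^ N * (real N)\<^sup>2 / real M + (r / \<rho>) ^ N))"
    using edmd_error[OF assms(4,3)[unfolded assms(2)]] by blast
  show ?thesis
  \<comment> \<open>16 is the constant of \<open>H_mat_coercive\<close>, with \<gamma>^N = (1 + sqrt
    2)^(2N).\<close>
  proof (rule exI[of _ 16], intro exI[of _ C] conjI allI impI)
    fix N M :: nat and \<delta> :: real
    assume "1 \<le> M" "0 \<le> \<delta>" "\<delta> \<le> 2 / real M" "16 * real N ^ 2 * \<gamma> ^ N \<le> real M"
    then show "l2_opnorm (\<lambda>k l. edmd_matrix T \<rho> N M \<delta> k l - transfer_matrix d phi \<rho> k l)
             \<le> ennreal (C * ((\<gamma> * r * R) powr (real N / 2) * real N ^ 2 / real M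
                               + (\<gamma> * r / R) powr (real N / 2)))"
      unfolding powr1 powr2 using C[of M \<delta> N] by (simp add: assms(2) power_mult)
  qed (use \<open>0 < C\<close> in auto)
qed

end
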